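(* The open unit ball $B_{\ell_1}$ of the complex Banach space $\ell_1$ is strongly pseudoconvex.
   Context: $bU$ denotes the boundary of $U$. Uniformly plurisubharmonic on average: for $U$ open in a complex Banach space $X$ and $L>0$, an upper semicontinuous $g:U\to[-\infty,\infty)$ is $L$-uniformly plurisubharmonic on average if there is a lower semicontinuous $\delta:U\to(0,\infty)$ such that for all $a\in U$ and $b\in X$ with $\|b\|<\delta(a)$ (where $\delta(a)$ is small enough that the closed disk $a+\overline{\mathbb{D}}b$ lies in $U$), $$L\|b\|^2+g(a)\le\frac1{2\pi}\int_0^{2\pi}g(a+e^{i\theta}b)\,d\theta.$$ $0$-uniformly pseudoconvex: a relatively compact open set $U\Subset\mathbb{C}^n$ is $0$-uniformly pseudoconvex if there exist positive constants $L,M,M'$, bounded neighborhoods $V_1,V_2$ of $bU$ with $V_2\supset\overline{V_1}$, and a function $r:V_2\to\mathbb{R}$ such that $U\cap V_2=\{z\in V_2:r(z)<0\}$ and $r$ is the (pointwise) limit on $V_2$ of a sequence $\{r_m\}$ of pointwise bounded $C^1$ functions $r_m:V_2\to\mathbb{R}$ such that each $r_m$ is $L$-uniformly plurisubharmonic on average on $V_2$ and $M'\ge\|\nabla r_m(z)\|\ge M$ for all $z\in\overline{V_1}$ and all $m$. Strongly pseudoconvex: a bounded open set $U$ in a complex Banach space $X$ is strongly pseudoconvex if $U\cap M$ is $0$-uniformly pseudoconvex for each finite-dimensional (complex linear) subspace $M$ of $X$, where $M$ is identified with some $\mathbb{C}^k$ by a linear isomorphism (all norms on $M$ being equivalent,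 this is independent of the choice). *)

theory Defs
  imports "HOL-Analysis.Analysis"
begin

section \<open>Complex normed and Banach spaces\<close>

text \<open>The underlying real structure is the one of the library; complex scalar multiplication
  is a further operation that extends real scalar multiplication.\<close>

class complex_normed_vector = real_normed_vector +
  fixes scaleC :: "complex \<Rightarrow> 'a \<Rightarrow> 'a" (infixr "*\<^sub>C" 75)
  assumes scaleC_add_right: "c *\<^sub>C (x + y) = c *\<^sub>C x + c *\<^sub>C y"
    and scaleC_add_left: "(c + d) *\<^sub>C x = c *\<^sub>C x + d *\<^sub>C x"
    and scaleC_scaleC: "c *\<^sub>C d *\<^sub>C x = (c * d) *\<^sub>C x"
    and scaleC_one: "1 *\<^sub>C x = x"
    and scaleR_scaleC: "r *\<^sub>R x = complex_of_real r *\<^sub>C x"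
    and norm_scaleC: "norm (c *\<^sub>C x) = cmod c * norm x"

class complex_banach = complex_normed_vector + banach

global_interpretation complex_vs:
  vector_space "scaleC :: complex \<Rightarrow> 'a \<Rightarrow> 'a::complex_normed_vector"
  by unfold_locales (simp_all add: scaleC_add_right scaleC_add_left scaleC_scaleC scaleC_one)

section \<open>The complex Banach space of absolutely summable sequences\<close>

typedef ell1 = "{x :: nat \<Rightarrow> complex. summable (\<lambda>i. cmod (x i))}"
  morphisms ell1_nth Abs_ell1
  by (rule exI[of _ "\<lambda>_. 0"]) simp

setup_lifting type_definition_ell1

lemma summable_cmod_ell1: "summable (\<lambda>i. cmod (ell1_nth x i))"
  using ell1_nth[of x] by simp

lemma ell1_eqI: "(\<And>i. ell1_nth x i = ell1_nth y i) \<Longrightarrow> x = y"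
  by (metis ell1_nth_inject ext)

instantiation ell1 :: complex_normed_vector
begin

lift_definition zero_ell1 :: ell1 is "\<lambda>_. 0" by simp

lift_definition plus_ell1 :: "ell1 \<Rightarrow> ell1 \<Rightarrow> ell1" is "\<lambda>x y i. x i + y i"
  subgoal for x y
    by (rule summable_comparison_test'[OF summable_add[of "\<lambda>i. cmod (x i)" "\<lambda>i. cmod (y i)"], of 0])
      (auto intro: norm_triangle_ineq)
  done

lift_definition minus_ell1 :: "ell1 \<Rightarrow> ell1 \<Rightarrow> ell1" is "\<lambda>x y i. x i - y i"
  subgoal for x y
    by (rule summable_comparison_test'[OF summable_add[of "\<lambda>i. cmod (x i)" "\<lambda>i. cmod (y i)"], of 0])
      (auto intro: norm_triangle_ineq4)
  done

lift_definition uminus_ell1 :: "ell1 \<Rightarrow> ell1" is "\<lambda>x i. - x i" by simp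

lift_definition scaleR_ell1 :: "real \<Rightarrow> ell1 \<Rightarrow> ell1" is "\<lambda>r x i. complex_of_real r * x i"
  by (simp add: norm_mult summable_mult)

lift_definition scaleC_ell1 :: "complex \<Rightarrow> ell1 \<Rightarrow> ell1" is "\<lambda>c x i. c * x i"
  by (simp add: norm_mult summable_mult)

definition norm_ell1 :: "ell1 \<Rightarrow> real" where
  "norm_ell1 x = (\<Sum>i. cmod (ell1_nth x i))"

definition dist_ell1 :: "ell1 \<Rightarrow> ell1 \<Rightarrow> real" where
  "dist_ell1 x y = norm (x - y)"

definition sgn_ell1 :: "ell1 \<Rightarrow> ell1" where
  "sgn_ell1 x = inverse (norm x) *\<^sub>R x"

definition uniformity_ell1 :: "(ell1 \<times> ell1) filter" where
  "uniformity_ell1 = (INF e\<in>{0<..}. principal {(x, y). dist x y < e})"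

definition open_ell1 :: "ell1 set \<Rightarrow> bool" where
  "open_ell1 U = (\<forall>x\<in>U. eventually (\<lambda>(x', y). x' = x \<longrightarrow> y \<in> U) uniformity)"

instance
proof
  fix x y z :: ell1 and a b :: real and c d :: complex
  show "x + y + z = x + (y + z)" "x + y = y + x" "0 + x = x" "- x + x = 0" "x - y = x + - y"
    by (transfer; auto simp: algebra_simps)+
  show "a *\<^sub>R (x + y) = a *\<^sub>R x + a *\<^sub>R y" "(a + b) *\<^sub>R x = a *\<^sub>R x + b *\<^sub>R x"
    "a *\<^sub>R b *\<^sub>R x = (a * b) *\<^sub>R x" "1 *\<^sub>R x = x"
    by (transfer; auto simp: algebra_simps)+
  show "c *\<^sub>C (x + y) = c *\<^sub>C x + c *\<^sub>C y" "(c + d) *\<^sub>C x = c *\<^sub>C x + d *\<^sub>C x"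
    "c *\<^sub>C d *\<^sub>C x = (c * d) *\<^sub>C x" "1 *\<^sub>C x = x" "a *\<^sub>R x = complex_of_real a *\<^sub>C x"
    by (transfer; auto simp: algebra_simps)+
  show "dist x y = norm (x - y)" by (rule dist_ell1_def)
  show "sgn x = inverse (norm x) *\<^sub>R x" by (rule sgn_ell1_def)
  show "uniformity = (INF e\<in>{0<..}. principal {(x :: ell1, y). dist x y < e})"
    by (rule uniformity_ell1_def)
  show "open U = (\<forall>x\<in>U. \<forall>\<^sub>F (x', y) in uniformity. x' = x \<longrightarrow> y \<in> U)" for U :: "ell1 set"
    by (rule open_ell1_def)
  show "(norm x = 0) = (x = 0)"
    unfolding norm_ell1_def suminf_eq_zero_iff[OF summable_cmod_ell1 norm_ge_zero]
    by (auto intro!: ell1_eqI simp: zero_ell1.rep_eq)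
  show "norm (x + y) \<le> norm x + norm y"
    unfolding norm_ell1_def suminf_add[OF summable_cmod_ell1 summable_cmod_ell1]
    by (intro suminf_le summable_add summable_cmod_ell1)
      (simp add: plus_ell1.rep_eq norm_triangle_ineq)
  show nC: "norm (c *\<^sub>C x) = cmod c * norm x" for c
    by (simp add: norm_ell1_def scaleC_ell1.rep_eq norm_mult suminf_mult summable_cmod_ell1)
  have "a *\<^sub>R x = complex_of_real a *\<^sub>C x" by transfer simp
  then show "norm (a *\<^sub>R x) = \<bar>a\<bar> * norm x" by (simp add: nC)
qed

end

lemma cmod_ell1_nth_le: "cmod (ell1_nth x i) \<le> norm x"
  unfolding norm_ell1_def
  using sum_le_suminf[OF summable_cmod_ell1, of "{i}" x] by simp

instance ell1 :: complex_banach
proof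
  fix X :: "nat \<Rightarrow> ell1" assume X: "Cauchy X"
  have "Cauchy (\<lambda>n. ell1_nth (X n) i)" for i
    unfolding Cauchy_def
  proof (intro allI impI)
    fix e :: real assume "e > 0"
    then obtain N where N: "\<And>m n. m \<ge> N \<Longrightarrow> n \<ge> N \<Longrightarrow> dist (X m) (X n) < e"
      using X unfolding Cauchy_def by blast
    have "dist (ell1_nth (X m) i) (ell1_nth (X n) i) < e" if "m \<ge> N" "n \<ge> N" for m n
      using N[OF that] cmod_ell1_nth_le[of "X m - X n" i]
      by (simp add: dist_norm minus_ell1.rep_eq)
    then show "\<exists>N. \<forall>m\<ge>N. \<forall>n\<ge>N. dist (ell1_nth (X m) i) (ell1_nth (X n) i) < e" by blast
  qed
  then have "\<exists>l. (\<lambda>n. ell1_nth (X n) i) \<longlonglongrightarrow> l" for i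
    using Cauchy_convergent convergent_def by blast
  then obtain l where l: "\<And>i. (\<lambda>n. ell1_nth (X n) i) \<longlonglongrightarrow> l i" by metis
  have tail: "\<exists>N. \<forall>m\<ge>N. \<forall>k. (\<Sum>i<k. cmod (ell1_nth (X m) i - l i)) \<le> e" if e: "e > 0" for e
  proof -
    obtain N where N: "\<And>m n. m \<ge> N \<Longrightarrow> n \<ge> N \<Longrightarrow> dist (X m) (X n) < e"
      using X e unfolding Cauchy_def by blast
    have "(\<Sum>i<k. cmod (ell1_nth (X m) i - l i)) \<le> e" if m: "m \<ge> N" for m k
    proof (rule tendsto_upperbound)
      show "(\<lambda>n. \<Sum>i<k. cmod (ell1_nth (X m) i - ell1_nth (X n) i))
          \<longlonglongrightarrow> (\<Sum>i<k. cmod (ell1_nth (X m) i - l i))"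
        by (intro tendsto_intros l)
      have "(\<Sum>i<k. cmod (ell1_nth (X m) i - ell1_nth (X n) i)) \<le> e" if "n \<ge> N" for n
        using N[OF m that] sum_le_suminf[OF summable_cmod_ell1, of "{..<k}" "X m - X n"]
        by (simp add: dist_norm norm_ell1_def minus_ell1.rep_eq)
      then show "\<forall>\<^sub>F n in sequentially. (\<Sum>i<k. cmod (ell1_nth (X m) i - ell1_nth (X n) i)) \<le> e"
        by (auto simp: eventually_sequentially)
    qed simp
    then show ?thesis by blast
  qed
  have sm: "summable (\<lambda>i. cmod (ell1_nth (X m) i - l i))"
    if "\<forall>k. (\<Sum>i<k. cmod (ell1_nth (X m) i - l i)) \<le> e" for m e
    by (rule bounded_imp_summable[of _ e]) (use that in \<open>auto simp del: sum.lessThan_Suc simp flip: lessThan_Suc_atMost\<close>)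
  obtain N1 where N1: "\<forall>m\<ge>N1. \<forall>k. (\<Sum>i<k. cmod (ell1_nth (X m) i - l i)) \<le> 1"
    using tail[of 1] by auto
  have "summable (\<lambda>i. cmod (l i))"
  proof (rule summable_comparison_test'[where N = 0])
    show "summable (\<lambda>i. cmod (ell1_nth (X N1) i - l i) + cmod (ell1_nth (X N1) i))"
      using N1 by (intro summable_add sm[of N1 1] summable_cmod_ell1) auto
    show "norm (cmod (l i)) \<le> cmod (ell1_nth (X N1) i - l i) + cmod (ell1_nth (X N1) i)" for i
      using norm_triangle_ineq4[of "ell1_nth (X N1) i" "ell1_nth (X N1) i - l i"] by simp
  qed
  then have nth: "ell1_nth (Abs_ell1 l) = l" by (simp add: Abs_ell1_inverse)
  have "X \<longlonglongrightarrow> Abs_ell1 l"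
  proof (rule LIMSEQ_I)
    fix e :: real assume "e > 0"
    then obtain N where N: "\<forall>m\<ge>N. \<forall>k. (\<Sum>i<k. cmod (ell1_nth (X m) i - l i)) \<le> e / 2"
      using tail[of "e / 2"] by auto
    have "norm (X m - Abs_ell1 l) < e" if "m \<ge> N" for m
    proof -
      have "norm (X m - Abs_ell1 l) \<le> e / 2"
        unfolding norm_ell1_def minus_ell1.rep_eq nth
        using N that by (intro suminf_le_const sm[of m "e / 2"]) auto
      then show ?thesis using \<open>e > 0\<close> by simp
    qed
    then show "\<exists>no. \<forall>n\<ge>no. norm (X n - Abs_ell1 l) < e" by blast
  qed
  then show "convergent X" by (auto simp: convergent_def)
qed

section \<open>The spaces \<open>\<complex>\<^sup>n\<close>\<close>

text \<open>The dimension \<open>n\<close> has to be quantified inside a definition, so it cannot be a type.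
  All \<open>\<complex>\<^sup>n\<close> are realised as coordinate subspaces of the space of finitely supported
  sequences with the Euclidean norm; topological notions and derivatives on \<open>\<complex>\<^sup>n\<close> are
  taken relative to that subspace.\<close>

typedef cfin = "{z :: nat \<Rightarrow> complex. finite {i. z i \<noteq> 0}}"
  morphisms coord Abs_cfin
  by (rule exI[of _ "\<lambda>_. 0"]) simp

setup_lifting type_definition_cfin

lemma finite_coord: "finite {i. coord z i \<noteq> 0}"
  using coord[of z] by simp

lemma cfin_eqI: "(\<And>i. coord x i = coord y i) \<Longrightarrow> x = y"
  by (metis coord_inject ext)

instantiation cfin :: real_inner
begin

lift_definition zero_cfin :: cfin is "\<lambda>_. 0" by simp

lift_definition plus_cfin :: "cfin \<Rightarrow> cfin \<Rightarrow> cfin" is "\<lambda>x y i. x i + y i"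
  subgoal for x y by (rule finite_subset[of _ "{i. x i \<noteq> 0} \<union> {i. y i \<noteq> 0}"]) auto
  done

lift_definition minus_cfin :: "cfin \<Rightarrow> cfin \<Rightarrow> cfin" is "\<lambda>x y i. x i - y i"
  subgoal for x y by (rule finite_subset[of _ "{i. x i \<noteq> 0} \<union> {i. y i \<noteq> 0}"]) auto
  done

lift_definition uminus_cfin :: "cfin \<Rightarrow> cfin" is "\<lambda>x i. - x i" by simp

lift_definition scaleR_cfin :: "real \<Rightarrow> cfin \<Rightarrow> cfin" is "\<lambda>r x i. complex_of_real r * x i"
  by simp

text \<open>The real inner product, that is, the real part of the Hermitian one.\<close>

definition inner_cfin :: "cfin \<Rightarrow> cfin \<Rightarrow> real" where
  "inner_cfin x y = (\<Sum>i | coord x i \<noteq> 0. inner (coord x i) (coord y i))"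

definition norm_cfin :: "cfin \<Rightarrow> real" where
  "norm_cfin x = sqrt (inner x x)"

definition dist_cfin :: "cfin \<Rightarrow> cfin \<Rightarrow> real" where
  "dist_cfin x y = norm (x - y)"

definition sgn_cfin :: "cfin \<Rightarrow> cfin" where
  "sgn_cfin x = inverse (norm x) *\<^sub>R x"

definition uniformity_cfin :: "(cfin \<times> cfin) filter" where
  "uniformity_cfin = (INF e\<in>{0<..}. principal {(x, y). dist x y < e})"

definition open_cfin :: "cfin set \<Rightarrow> bool" where
  "open_cfin U = (\<forall>x\<in>U. eventually (\<lambda>(x', y). x' = x \<longrightarrow> y \<in> U) uniformity)"

instance
proof
  fix x y z :: cfin and a b :: real
  have inner_on: "inner x y = (\<Sum>i\<in>A. inner (coord x i) (coord y i))"
    if "finite A" "{i. coord x i \<noteq> 0} \<subseteq> A" for A x y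
    unfolding inner_cfin_def by (rule sum.mono_neutral_left) (use that in auto)
  define A where "A = {i. coord x i \<noteq> 0} \<union> {i. coord y i \<noteq> 0}"
  have A: "finite A" by (simp add: A_def finite_coord)
  show "x + y + z = x + (y + z)" "x + y = y + x" "0 + x = x" "- x + x = 0" "x - y = x + - y"
    by (transfer; auto simp: algebra_simps)+
  show "a *\<^sub>R (x + y) = a *\<^sub>R x + a *\<^sub>R y" "(a + b) *\<^sub>R x = a *\<^sub>R x + b *\<^sub>R x"
    "a *\<^sub>R b *\<^sub>R x = (a * b) *\<^sub>R x" "1 *\<^sub>R x = x"
    by (transfer; auto simp: algebra_simps)+
  show "dist x y = norm (x - y)" by (rule dist_cfin_def)
  show "sgn x = inverse (norm x) *\<^sub>R x" by (rule sgn_cfin_def)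
  show "uniformity = (INF e\<in>{0<..}. principal {(x :: cfin, y). dist x y < e})"
    by (rule uniformity_cfin_def)
  show "open U = (\<forall>x\<in>U. \<forall>\<^sub>F (x', y) in uniformity. x' = x \<longrightarrow> y \<in> U)" for U :: "cfin set"
    by (rule open_cfin_def)
  show "norm x = sqrt (inner x x)" by (rule norm_cfin_def)
  show "inner x y = inner y x"
    using inner_on[OF A, of x y] inner_on[OF A, of y x] by (auto simp: A_def inner_commute)
  show "inner (x + y) z = inner x z + inner y z"
  proof -
    have "{i. coord (x + y) i \<noteq> 0} \<subseteq> A" by (auto simp: A_def plus_cfin.rep_eq)
    then show ?thesis
      using inner_on[OF A, of x z] inner_on[OF A, of y z] inner_on[OF A, of "x + y" z]
      by (auto simp: A_def plus_cfin.rep_eq inner_add_left sum.distrib)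
  qed
  show "inner (a *\<^sub>R x) y = a * inner x y"
  proof -
    have "{i. coord (a *\<^sub>R x) i \<noteq> 0} \<subseteq> A" by (auto simp: A_def scaleR_cfin.rep_eq)
    then show ?thesis
      using inner_on[OF A, of x y] inner_on[OF A, of "a *\<^sub>R x" y]
      by (auto simp: A_def scaleR_cfin.rep_eq sum_distrib_left scaleR_conv_of_real[symmetric])
  qed
  show "0 \<le> inner x x" by (simp add: inner_cfin_def sum_nonneg)
  show "inner x x = 0 \<longleftrightarrow> x = 0"
    unfolding inner_cfin_def sum_nonneg_eq_0_iff[OF finite_coord inner_ge_zero]
    by (auto intro!: cfin_eqI simp: zero_cfin.rep_eq)
qed

end

instantiation cfin :: complex_normed_vector
begin

lift_definition scaleC_cfin :: "complex \<Rightarrow> cfin \<Rightarrow> cfin" is "\<lambda>c x i. c * x i"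
  by simp

instance
proof
  fix x y :: cfin and a :: real and c d :: complex
  show "c *\<^sub>C (x + y) = c *\<^sub>C x + c *\<^sub>C y" "(c + d) *\<^sub>C x = c *\<^sub>C x + d *\<^sub>C x"
    "c *\<^sub>C d *\<^sub>C x = (c * d) *\<^sub>C x" "1 *\<^sub>C x = x" "a *\<^sub>R x = complex_of_real a *\<^sub>C x"
    by (transfer; auto simp: algebra_simps)+
  have "inner (c *\<^sub>C x) (c *\<^sub>C x) = (cmod c)\<^sup>2 * inner x x"
  proof -
    have "inner (c *\<^sub>C x) (c *\<^sub>C x)
        = (\<Sum>i | coord x i \<noteq> 0. inner (coord (c *\<^sub>C x) i) (coord (c *\<^sub>C x) i))"
      unfolding inner_cfin_def
      by (rule sum.mono_neutral_left) (auto simp: finite_coord scaleC_cfin.rep_eq)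
    also have "\<dots> = (cmod c)\<^sup>2 * inner x x"
      by (simp add: inner_cfin_def scaleC_cfin.rep_eq sum_distrib_left norm_mult
          power_mult_distrib flip: power2_norm_eq_inner)
    finally show ?thesis .
  qed
  then show "norm (c *\<^sub>C x) = cmod c * norm x" by (simp add: norm_cfin_def real_sqrt_mult)
qed

end

definition Cspace :: "nat \<Rightarrow> cfin set" where
  "Cspace n = {z. \<forall>i\<ge>n. coord z i = 0}"

lemma norm_Cspace:
  assumes "z \<in> Cspace n"
  shows "norm z = sqrt (\<Sum>i<n. (cmod (coord z i))\<^sup>2)"
proof -
  have "inner z z = (\<Sum>i<n. inner (coord z i) (coord z i))"
    unfolding inner_cfin_def
    by (rule sum.mono_neutral_left) (use assms in \<open>auto simp: Cspace_def not_le[symmetric]\<close>)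
  then show ?thesis by (simp add: norm_cfin_def power2_norm_eq_inner)
qed

lemma finite_dim_coordinates:
  fixes M :: "'a::complex_normed_vector set"
  assumes "finite B" "complex_vs.span B = M"
  shows "\<exists>k \<phi>. Vector_Spaces.linear (scaleC :: complex \<Rightarrow> cfin \<Rightarrow> cfin) scaleC \<phi> \<and>
               bij_betw \<phi> (Cspace k) M"
proof -
  obtain B' where B': "B' \<subseteq> B" "complex_vs.independent B'" "B \<subseteq> complex_vs.span B'"
    using complex_vs.maximal_independent_subset[of B] by blast
  have fin: "finite B'" using B'(1) assms(1) finite_subset by blast
  have span: "complex_vs.span B' = M"
    using B' assms(2) complex_vs.span_mono complex_vs.span_minimal complex_vs.subspace_span
    by (metis subset_antisym)
  obtain e where e: "bij_betw e {..<card B'} B'"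
    using ex_bij_betw_nat_finite[OF fin] by (auto simp: atLeast0LessThan)
  define \<phi> where "\<phi> z = (\<Sum>i<card B'. coord z i *\<^sub>C e i)" for z
  have lin: "Vector_Spaces.linear (scaleC :: complex \<Rightarrow> cfin \<Rightarrow> cfin) scaleC \<phi>"
    by unfold_locales (simp_all add: \<phi>_def plus_cfin.rep_eq scaleC_cfin.rep_eq scaleC_add_left
        sum.distrib complex_vs.scale_sum_right)
  have reindex: "(\<Sum>i<card B'. f (e i) *\<^sub>C e i) = (\<Sum>b\<in>B'. f b *\<^sub>C b)" for f :: "'a \<Rightarrow> complex"
    using sum.reindex_bij_betw[OF e, of "\<lambda>b. f b *\<^sub>C b"] .
  have ran: "\<phi> z \<in> M" for z
    unfolding \<phi>_def span[symmetric]
    by (intro complex_vs.span_sum complex_vs.span_scale complex_vs.span_base)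
      (use e bij_betwE in blast)
  have onto: "\<exists>z \<in> Cspace (card B'). \<phi> z = v" if v: "v \<in> M" for v
  proof -
    obtain u where u: "v = (\<Sum>b\<in>B'. u b *\<^sub>C b)"
      using v unfolding span[symmetric] complex_vs.span_finite[OF fin] by blast
    define w where "w i = (if i < card B' then u (e i) else 0)" for i
    have "finite {i. w i \<noteq> 0}" by (rule finite_subset[of _ "{..<card B'}"]) (auto simp: w_def)
    then have c: "coord (Abs_cfin w) = w" by (simp add: Abs_cfin_inverse)
    have "\<phi> (Abs_cfin w) = v" by (simp add: \<phi>_def c w_def u reindex)
    moreover have "Abs_cfin w \<in> Cspace (card B')" by (simp add: Cspace_def c w_def)
    ultimately show ?thesis by blast
  qed
  have inj: "x = y" if x: "x \<in> Cspace (card B')" and y: "y \<in> Cspace (card B')" and eq: "\<phi> x = \<phi> y"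
    for x y
  proof -
    define u where "u b = coord x (inv_into {..<card B'} e b) - coord y (inv_into {..<card B'} e b)" for b
    have ue: "u (e i) = coord x i - coord y i" if "i < card B'" for i
      using e that by (simp add: u_def bij_betw_inv_into_left)
    have "(\<Sum>b\<in>B'. u b *\<^sub>C b) = (\<Sum>i<card B'. (coord x i - coord y i) *\<^sub>C e i)"
      unfolding reindex[symmetric] by (simp add: ue)
    also have "\<dots> = \<phi> x - \<phi> y"
      by (simp add: \<phi>_def complex_vs.scale_left_diff_distrib sum_subtractf)
    finally have "(\<Sum>b\<in>B'. u b *\<^sub>C b) = 0" using eq by simp
    then have u0: "u b = 0" if "b \<in> B'" for b
      using complex_vs.independentD[OF B'(2) fin order_refl _ that] by blast
    have "coord x i = coord y i" for i
    proof (cases "i < card B'")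
      case True
      then have "e i \<in> B'" using e bij_betwE by blast
      then show ?thesis using u0 ue[OF True] by fastforce
    next
      case False
      then show ?thesis using x y by (simp add: Cspace_def)
    qed
    then show ?thesis by (rule cfin_eqI)
  qed
  have "bij_betw \<phi> (Cspace (card B')) M"
    unfolding bij_betw_def inj_on_def using ran onto inj by (auto 4 3)
  with lin show ?thesis by blast
qed

section \<open>Uniform plurisubharmonicity on average\<close>

definition upper_semicontinuous_on :: "'a::topological_space set \<Rightarrow> ('a \<Rightarrow> 'b::linorder) \<Rightarrow> bool" where
  "upper_semicontinuous_on U g \<longleftrightarrow> (\<forall>c. openin (top_of_set U) {x \<in> U. g x < c})"

definition lower_semicontinuous_on :: "'a::topological_space set \<Rightarrow> ('a \<Rightarrow> 'b::linorder) \<Rightarrow> bool" where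
  "lower_semicontinuous_on U g \<longleftrightarrow> (\<forall>c. openin (top_of_set U) {x \<in> U. c < g x})"

text \<open>The integral of the positive part minus the integral of the negative part (both
  in \<open>[0, \<infinity>]\<close>; \<open>e2ennreal\<close> sends negative arguments to 0). In the use below the first one is finite,
  as an upper semicontinuous function without the value \<open>\<infinity>\<close> is bounded above on a circle.\<close>

definition ereal_integral :: "'a measure \<Rightarrow> ('a \<Rightarrow> ereal) \<Rightarrow> ereal" where
  "ereal_integral M f =
     enn2ereal (\<integral>\<^sup>+x. e2ennreal (f x) \<partial>M) - enn2ereal (\<integral>\<^sup>+x. e2ennreal (- f x) \<partial>M)"

definition circle_mean :: "('a::complex_normed_vector \<Rightarrow> ereal) \<Rightarrow> 'a \<Rightarrow> 'a \<Rightarrow> ereal" where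
  "circle_mean g a b = ereal (1 / (2 * pi)) *
     ereal_integral (restrict_space lborel {0..2 * pi}) (\<lambda>\<theta>. g (a + cis \<theta> *\<^sub>C b))"

text \<open>Here \<open>X\<close> is the carrier of the Banach space, a complex subspace of the type \<open>'a\<close>,
  and \<open>U\<close> is an open subset of \<open>X\<close>. Only the values of \<open>g\<close> on \<open>U\<close> matter.\<close>

definition unif_psh_on_average ::
    "real \<Rightarrow> 'a::complex_normed_vector set \<Rightarrow> 'a set \<Rightarrow> ('a \<Rightarrow> ereal) \<Rightarrow> bool" where
  "unif_psh_on_average L X U g \<longleftrightarrow>
     0 < L \<and> openin (top_of_set X) U \<and>
     (\<forall>x\<in>U. g x \<noteq> \<infinity>) \<and> upper_semicontinuous_on U g \<and>
     (\<exists>\<delta> :: 'a \<Rightarrow> real. lower_semicontinuous_on U \<delta> \<and> (\<forall>a\<in>U. 0 < \<delta> a) \<and>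
       (\<forall>a\<in>U. \<forall>b\<in>X. norm b < \<delta> a \<longrightarrow>
          (\<forall>\<zeta>. cmod \<zeta> \<le> 1 \<longrightarrow> a + \<zeta> *\<^sub>C b \<in> U) \<and>
          ereal (L * (norm b)\<^sup>2) + g a \<le> circle_mean g a b))"

section \<open>Pseudoconvexity\<close>

text \<open>\<open>G\<close> is the (continuous) gradient of the \<open>C\<^sup>1\<close> function \<open>f\<close> on the open set
  \<open>V \<subseteq> \<complex>\<^sup>n = \<real>\<^bsup>2n\<^esup>\<close>, with respect to the real inner product.\<close>

definition C1_with_gradient ::
    "nat \<Rightarrow> cfin set \<Rightarrow> (cfin \<Rightarrow> real) \<Rightarrow> (cfin \<Rightarrow> cfin) \<Rightarrow> bool" where
  "C1_with_gradient n V f G \<longleftrightarrow>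
     (\<forall>z\<in>V. G z \<in> Cspace n \<and>
        (f has_derivative (\<lambda>h. inner (G z) h)) (at z within Cspace n)) \<and>
     continuous_on V G"

text \<open>The lower and upper bounds on the gradients are \<open>m\<close> and \<open>m'\<close>; the letter \<open>M\<close> is kept for subspaces.\<close>

definition zero_unif_pseudoconvex :: "nat \<Rightarrow> cfin set \<Rightarrow> bool" where
  "zero_unif_pseudoconvex n U \<longleftrightarrow>
     openin (top_of_set (Cspace n)) U \<and>
     compact (top_of_set (Cspace n) closure_of U) \<and>
     (\<exists>(L::real) (m::real) (m'::real) V1 V2 (r :: cfin \<Rightarrow> real) (rs :: nat \<Rightarrow> cfin \<Rightarrow> real) G.
        0 < L \<and> 0 < m \<and> 0 < m' \<and>
        openin (top_of_set (Cspace n)) V1 \<and> bounded V1 \<and>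
        top_of_set (Cspace n) frontier_of U \<subseteq> V1 \<and>
        openin (top_of_set (Cspace n)) V2 \<and> bounded V2 \<and>
        top_of_set (Cspace n) closure_of V1 \<subseteq> V2 \<and>
        U \<inter> V2 = {z \<in> V2. r z < 0} \<and>
        (\<forall>z\<in>V2. (\<lambda>k. rs k z) \<longlonglongrightarrow> r z) \<and>
        (\<forall>z\<in>V2. bounded (range (\<lambda>k. rs k z))) \<and>
        (\<forall>k. C1_with_gradient n V2 (rs k) (G k)) \<and>
        (\<forall>k. unif_psh_on_average L (Cspace n) V2 (\<lambda>z. ereal (rs k z))) \<and>
        (\<forall>k. \<forall>z \<in> top_of_set (Cspace n) closure_of V1.
           m \<le> norm (G k z) \<and> norm (G k z) \<le> m'))"

text \<open>Identifications of \<open>M\<close> with \<open>\<complex>\<^sup>k\<close> are given by linear maps \<open>\<phi>\<close> on the whole type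
  that are bijective from \<open>\<complex>\<^sup>k\<close> onto \<open>M\<close>; the values outside \<open>\<complex>\<^sup>k\<close> are irrelevant, and every
  linear isomorphism from \<open>\<complex>\<^sup>k\<close> to \<open>M\<close> is the restriction of such a map. The condition
  does not depend on the choice of \<open>\<phi>\<close>, and is required for all of them;
  by \<open>finite_dim_coordinates\<close> there is always one.\<close>

definition strongly_pseudoconvex :: "'a::complex_banach set \<Rightarrow> bool" where
  "strongly_pseudoconvex U \<longleftrightarrow>
     bounded U \<and> open U \<and>
     (\<forall>M. complex_vs.subspace M \<and> (\<exists>B. finite B \<and> complex_vs.span B = M) \<longrightarrow>
       (\<forall>k \<phi>. Vector_Spaces.linear (scaleC :: complex \<Rightarrow> cfin \<Rightarrow> cfin) scaleC \<phi> \<and>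
               bij_betw \<phi> (Cspace k) M \<longrightarrow>
          zero_unif_pseudoconvex k {z \<in> Cspace k. \<phi> z \<in> U \<inter> M}))"

end

theory Submission
  imports Defs
begin

text \<open>
  Let \<open>\<phi>\<close> be a linear isomorphism from \<open>\<complex>\<^sup>k\<close> onto a finite-dimensional subspace of \<open>\<ell>\<^sub>1\<close>. Then
  \<open>norm (\<phi> z) = \<Sum>i. |l\<^sub>i(z)|\<close>, where the \<open>l\<^sub>i\<close> are the coordinates of \<open>\<phi>\<close>, and the norms of these
  functionals are summable since \<open>\<phi>\<close> is determined by \<open>k\<close> vectors of \<open>\<ell>\<^sub>1\<close>
  (\<open>summable_functionals_into_ell1\<close>). The section of the ball is \<open>{z. norm (\<phi> z) - 1 < 0}\<close>, and
  \<open>norm (\<phi> z) - 1\<close> is the limit of the smooth functions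
  \<open>r(z) = (\<Sum>i<n. \<surd>(|l\<^sub>i(z)|\<^sup>2 + e\<^sup>2)) - 1\<close>, when \<open>n \<rightarrow> \<infinity>\<close> and \<open>n e \<rightarrow> 0\<close>.

  The modulus of a complex number is subharmonic, and strictly so in a quantitative sense: its
  Laplacian at \<open>a\<close> is \<open>1 / |a|\<close>. The smoothed modulus \<open>\<surd>(|a|\<^sup>2 + e\<^sup>2)\<close> inherits this with a
  constant that is uniform in \<open>e\<close> on bounded sets; the proof compares it on small circles
  with a constant plus harmonic terms of degrees one and two (\<open>smoothed_modulus_ge_harmonic\<close>).
  Summing over \<open>i\<close>, the mean of \<open>r\<close> over a circle in direction \<open>b\<close> exceeds its value at the centre
  by a constant times \<open>\<Sum>i<n. |l\<^sub>i(b)|\<^sup>2\<close>. Finitely many of the \<open>l\<^sub>i\<close> already separate the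
  points of \<open>\<complex>\<^sup>k\<close>, so this dominates a multiple of \<open>norm b ^ 2\<close>
  that does not depend on \<open>n\<close> (\<open>finitely_many_functionals_suffice\<close>, \<open>unif_psh_smoothed_norm\<close>).

  The gradients of the functions \<open>r\<close> are bounded by the sum of the norms of the \<open>l\<^sub>i\<close>. They are
  bounded away from zero near the unit sphere because the radial derivative of a norm is
  the norm itself, which persists up to the error \<open>n e\<close> and the tail of the series
  (\<open>inner_smoothed_gradient_ge\<close>).
\<close>

section \<open>The Hermitian pairing and compactness in \<open>\<complex>\<^sup>n\<close>\<close>

lemma inner_cfin_on:
  assumes "finite A" "{i. coord x i \<noteq> 0} \<subseteq> A"
  shows "inner x y = (\<Sum>i\<in>A. inner (coord x i) (coord y i))"
  unfolding inner_cfin_def by (rule sum.mono_neutral_left) (use assms in auto)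

text \<open>The Hermitian inner product of \<open>\<complex>\<^sup>n\<close>, linear in its first argument. The support of \<open>w\<close>
  bounds the summation, so that linearity in \<open>z\<close> is immediate; every linear functional on
  \<open>\<complex>\<^sup>n\<close> is of the form \<open>z \<mapsto> hpair z w\<close>.\<close>

definition hpair :: "cfin \<Rightarrow> cfin \<Rightarrow> complex" where
  "hpair z w = (\<Sum>j | coord w j \<noteq> 0. coord z j * cnj (coord w j))"

lemma hpair_add: "hpair (x + y) w = hpair x w + hpair y w"
  by (simp add: hpair_def plus_cfin.rep_eq distrib_right sum.distrib)

lemma hpair_scaleC: "hpair (c *\<^sub>C z) w = c * hpair z w"
  by (simp add: hpair_def scaleC_cfin.rep_eq sum_distrib_left mult.assoc)

text \<open>The real inner product is the real part of the Hermitian one. In this form the lemma turns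
  the derivative of a function of \<open>hpair z w\<close> into a gradient, a complex multiple of \<open>w\<close>.\<close>

lemma inner_scaleC_hpair: "inner (c *\<^sub>C w) z = inner c (hpair z w)"
proof -
  have "inner (c *\<^sub>C w) z = (\<Sum>j | coord w j \<noteq> 0. inner (c * coord w j) (coord z j))"
    by (subst inner_cfin_on[OF finite_coord[of w]]) (auto simp: scaleC_cfin.rep_eq)
  also have "\<dots> = inner c (hpair z w)"
    unfolding hpair_def inner_sum_right
    by (rule sum.cong) (auto simp: inner_complex_def algebra_simps)
  finally show ?thesis .
qed

lemma cmod_hpair_le: "cmod (hpair z w) \<le> norm w * norm z"
proof -
  have "(cmod (hpair z w))\<^sup>2 = inner (hpair z w *\<^sub>C w) z"
    by (simp add: inner_scaleC_hpair power2_norm_eq_inner)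
  also have "\<dots> \<le> cmod (hpair z w) * (norm w * norm z)"
    using Cauchy_Schwarz_ineq2[of "hpair z w *\<^sub>C w" z] by (simp add: norm_scaleC mult.assoc)
  finally show ?thesis
    by (cases "hpair z w = 0") (simp_all add: power2_eq_square)
qed

lemma bounded_linear_hpair: "bounded_linear (\<lambda>z. hpair z w)"
proof (rule bounded_linear_intro)
  show "hpair (r *\<^sub>R z) w = r *\<^sub>R hpair z w" for r z
    by (simp add: scaleR_scaleC hpair_scaleC scaleR_conv_of_real)
  show "cmod (hpair z w) \<le> norm z * norm w" for z
    using cmod_hpair_le[of z w] by (simp add: mult.commute)
qed (rule hpair_add)

lemma bounded_linear_scaleC_left: "bounded_linear (\<lambda>c. c *\<^sub>C (x :: 'a::complex_normed_vector))"
  by (rule bounded_linear_intro[of _ "norm x"])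
    (simp_all add: scaleC_add_left scaleR_scaleC scaleC_scaleC norm_scaleC scaleR_conv_of_real)

lemma Cspace_add: "x \<in> Cspace k \<Longrightarrow> y \<in> Cspace k \<Longrightarrow> x + y \<in> Cspace k"
  by (simp add: Cspace_def plus_cfin.rep_eq)

lemma Cspace_scaleC: "x \<in> Cspace k \<Longrightarrow> c *\<^sub>C x \<in> Cspace k"
  by (simp add: Cspace_def scaleC_cfin.rep_eq)

lemma Cspace_sum: "(\<And>i. i \<in> A \<Longrightarrow> f i \<in> Cspace k) \<Longrightarrow> sum f A \<in> Cspace k"
  by (induction A rule: infinite_finite_induct)
    (auto intro!: Cspace_add, auto simp: Cspace_def zero_cfin.rep_eq)

lemma cmod_coord_le: "cmod (coord z j) \<le> norm z"
proof (cases "coord z j = 0")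
  case False
  have "(cmod (coord z j))\<^sup>2 \<le> inner z z"
    unfolding inner_cfin_def power2_norm_eq_inner
    by (rule member_le_sum) (use False finite_coord in auto)
  then show ?thesis by (simp add: norm_cfin_def real_le_rsqrt)
qed simp

definition basis_vec :: "nat \<Rightarrow> cfin" where
  "basis_vec j = Abs_cfin (\<lambda>i. if i = j then 1 else 0)"

lemma coord_basis_vec: "coord (basis_vec j) i = (if i = j then 1 else 0)"
proof -
  have "finite {i. (if i = j then 1 else 0 :: complex) \<noteq> 0}" by (rule finite_subset[of _ "{j}"]) auto
  then show ?thesis by (simp add: basis_vec_def Abs_cfin_inverse)
qed

text \<open>The Heine--Borel property of \<open>\<complex>\<^sup>k\<close> by induction on \<open>k\<close>: the box in \<open>\<complex>\<^bsup>k+1\<^esup>\<close> is a continuous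
  image of a disc times the box in \<open>\<complex>\<^sup>k\<close>.\<close>

lemma compact_box_Cspace: "compact {z \<in> Cspace k. \<forall>i. cmod (coord z i) \<le> R}" (is "compact (?K k)")
proof (cases "R \<ge> 0")
  case False
  then have "\<not> cmod c \<le> R" for c :: complex using norm_ge_zero[of c] by linarith
  then show ?thesis by simp
next
  case True
  show ?thesis
  proof (induction k)
    case 0
    have "?K 0 \<subseteq> {0}" by (auto simp: Cspace_def zero_cfin.rep_eq intro: cfin_eqI)
    then show ?case by (meson finite.emptyI finite_insert finite_subset finite_imp_compact)
  next
    case (Suc k)
    let ?f = "\<lambda>(c, z). z + c *\<^sub>C basis_vec k"
    have "continuous_on (cball 0 R \<times> ?K k) ?f"
      unfolding case_prod_unfold
      by (intro continuous_intros bounded_linear.continuous_on[OF bounded_linear_scaleC_left])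
    then have "compact (?f ` (cball 0 R \<times> ?K k))"
      by (rule compact_continuous_image) (intro compact_Times compact_cball Suc)
    also have "?f ` (cball 0 R \<times> ?K k) = ?K (Suc k)"
    proof (intro equalityI subsetI)
      fix z assume "z \<in> ?f ` (cball 0 R \<times> ?K k)"
      then show "z \<in> ?K (Suc k)"
        by (auto simp: Cspace_def plus_cfin.rep_eq scaleC_cfin.rep_eq coord_basis_vec)
    next
      fix z assume z: "z \<in> ?K (Suc k)"
      let ?y = "z - coord z k *\<^sub>C basis_vec k"
      have y: "coord ?y i = (if i = k then 0 else coord z i)" for i
        by (simp add: minus_cfin.rep_eq scaleC_cfin.rep_eq coord_basis_vec)
      have "?y \<in> Cspace k" using z unfolding Cspace_def mem_Collect_eq y
        by (auto simp: Suc_le_eq)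
      then have "?y \<in> ?K k" using z True by (auto simp: y)
      then show "z \<in> ?f ` (cball 0 R \<times> ?K k)"
        using z by (intro rev_image_eqI[of "(coord z k, ?y)"]) auto
    qed
    finally show ?case .
  qed
qed

lemma bounded_linear_coord: "bounded_linear (\<lambda>z. coord z j)"
  by (rule bounded_linear_intro[of _ 1])
    (simp_all add: plus_cfin.rep_eq scaleR_cfin.rep_eq scaleR_conv_of_real cmod_coord_le)

lemma closed_Cspace: "closed (Cspace k)"
  unfolding Cspace_def
  by (intro closed_Collect_all closed_Collect_imp closed_Collect_eq open_Collect_const
      bounded_linear.continuous_on[OF bounded_linear_coord] continuous_intros)

lemma compact_Cspace:
  assumes "closed S" "bounded S"
  shows "compact (Cspace k \<inter> S)"
proof -
  obtain R where R: "\<And>z. z \<in> S \<Longrightarrow> norm z \<le> R" using assms(2) by (auto simp: bounded_iff)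
  have "Cspace k \<inter> S = {z \<in> Cspace k. \<forall>i. cmod (coord z i) \<le> R} \<inter> S"
    using R cmod_coord_le order_trans by blast
  then show ?thesis using compact_Int_closed[OF compact_box_Cspace assms(1)] by simp
qed

section \<open>Harmonic minorants and circle means\<close>

text \<open>A quadratic minorant of \<open>\<surd>(s\<^sup>2 + u)\<close> in \<open>u\<close>. The Taylor coefficient of \<open>u\<^sup>2 / s\<^sup>3\<close> is \<open>-1/8\<close>; it is
  worsened to \<open>-2/9\<close>, which makes the minorant valid on a whole interval and still leaves a gain
  in \<open>smoothed_modulus_ge_harmonic\<close>, where any coefficient above \<open>-1/4\<close> would do. With
  \<open>y = \<surd>(s\<^sup>2 + u)\<close> the difference of the two sides is a multiple of
  \<open>(y - s)\<^sup>2 (4 (y + s)\<^sup>2 - 9 s\<^sup>2)\<close>, and \<open>y \<ge> s / 2\<close>.\<close>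

lemma sqrt_ge_quadratic:
  fixes s u :: real
  assumes s: "s > 0" and u: "\<bar>u\<bar> \<le> 3 / 4 * s\<^sup>2"
  shows "s + u / (2 * s) - 2 * u\<^sup>2 / (9 * s ^ 3) \<le> sqrt (s\<^sup>2 + u)"
proof -
  define y where "y = sqrt (s\<^sup>2 + u)"
  have "(s / 2)\<^sup>2 \<le> s\<^sup>2 + u" using u by (simp add: power2_eq_square)
  then have y: "s / 2 \<le> y" unfolding y_def by (rule real_le_rsqrt)
  have "0 \<le> s\<^sup>2 + u" using u by (simp add: abs_le_iff)
  then have yy: "u = y\<^sup>2 - s\<^sup>2" by (simp add: y_def)
  have "(3 * s)\<^sup>2 \<le> (2 * (y + s))\<^sup>2" using y s by (intro power_mono) auto
  then have "9 * s\<^sup>2 \<le> 4 * (y + s)\<^sup>2" unfolding power_mult_distrib by simp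
  then have "0 \<le> (y - s)\<^sup>2 * (4 * (y + s)\<^sup>2 - 9 * s\<^sup>2)"
    by (intro mult_nonneg_nonneg) simp_all
  also have "\<dots> = 18 * s ^ 3 * (y - (s + u / (2 * s) - 2 * u\<^sup>2 / (9 * s ^ 3)))"
    unfolding yy using s by (simp add: field_simps) algebra
  finally show ?thesis using s by (simp add: zero_le_mult_iff y_def)
qed

text \<open>The analytic core. Put \<open>S = \<surd>(|a|\<^sup>2 + e\<^sup>2)\<close>, \<open>p = a\<^sup>* b\<close> with \<open>a\<^sup>*\<close> the conjugate of \<open>a\<close>,
  and \<open>t = Re (p \<zeta>)\<close>. On the circle \<open>|\<zeta>| = 1\<close>,
  \<open>|a + \<zeta> b|\<^sup>2 + e\<^sup>2 = S\<^sup>2 + |b|\<^sup>2 + 2t\<close>, to which the quadratic minorant applies. There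
  \<open>2t\<^sup>2 = |p|\<^sup>2 + Re (p\<^sup>2 \<zeta>\<^sup>2)\<close>, so up to harmonic terms without constant part the minorant is
  \<open>S + |b|\<^sup>2 / (2S) - (2/9) (|b|\<^sup>4 + 2|p|\<^sup>2) / S\<^sup>3\<close>, and \<open>|p|\<^sup>2 \<le> S\<^sup>2 |b|\<^sup>2\<close> keeps the loss below the
  gain. The gain depends on \<open>e\<close> only through \<open>S\<close>; merely the admissible size of \<open>b\<close> shrinks
  with \<open>e\<close>. The harmonic terms are kept, rather than averaged out, so that such estimates can be
  added before a single integration.\<close>

lemma smoothed_modulus_ge_harmonic:
  fixes a b :: complex
  assumes e: "e > 0" and b: "cmod b \<le> e / 4"
  shows "\<exists>c d. \<forall>\<zeta>. cmod \<zeta> = 1 \<longrightarrow>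
    sqrt ((cmod a)\<^sup>2 + e\<^sup>2) + (cmod b)\<^sup>2 / (24 * sqrt ((cmod a)\<^sup>2 + e\<^sup>2)) + Re (c * \<zeta> + d * \<zeta>\<^sup>2)
      \<le> sqrt ((cmod (a + \<zeta> * b))\<^sup>2 + e\<^sup>2)"
proof -
  define s where "s = sqrt ((cmod a)\<^sup>2 + e\<^sup>2)"
  define B where "B = (cmod b)\<^sup>2"
  define p where "p = cnj a * b"
  have ss: "s\<^sup>2 = (cmod a)\<^sup>2 + e\<^sup>2" by (simp add: s_def)
  have s: "s > 0" using e unfolding s_def by (intro real_sqrt_gt_zero add_nonneg_pos) auto
  have "e \<le> s" "cmod a \<le> s" using e unfolding s_def by (auto intro!: real_le_rsqrt)
  then have bs: "cmod b \<le> s / 4" using b by simp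
  have "B \<le> (s / 4)\<^sup>2" unfolding B_def using bs by (intro power_mono) auto
  then have Bs: "B \<le> s\<^sup>2 / 16" by (simp add: power_divide)
  have B0: "B \<ge> 0" by (simp add: B_def)
  have ps: "(cmod p)\<^sup>2 \<le> s\<^sup>2 * B"
    unfolding p_def B_def norm_mult power_mult_distrib by (intro mult_right_mono) (auto simp: ss)
  have "s + B / (24 * s) + Re (of_real (1 / s - 8 * B / (9 * s ^ 3)) * p * \<zeta> + (- of_real (4 / (9 * s ^ 3)) * p\<^sup>2) * \<zeta>\<^sup>2)
      \<le> sqrt ((cmod (a + \<zeta> * b))\<^sup>2 + e\<^sup>2)" if \<zeta>: "cmod \<zeta> = 1" for \<zeta>
  proof -
    define t where "t = Re (p * \<zeta>)"
    have tp: "\<bar>t\<bar> \<le> cmod p" unfolding t_def using abs_Re_le_cmod[of "p * \<zeta>"] \<zeta> by (simp add: norm_mult)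
    have "cmod p \<le> s * (s / 4)"
      unfolding p_def norm_mult using bs \<open>cmod a \<le> s\<close> s by (intro mult_mono) auto
    then have u: "\<bar>B + 2 * t\<bar> \<le> 3 / 4 * s\<^sup>2"
      using tp Bs B0 by (simp add: power2_eq_square abs_if split: if_splits) 
    have z: "(cmod (a + \<zeta> * b))\<^sup>2 + e\<^sup>2 = s\<^sup>2 + (B + 2 * t)"
    proof -
      have "(cmod (a + \<zeta> * b))\<^sup>2 = (cmod a)\<^sup>2 + (cmod (\<zeta> * b))\<^sup>2 + 2 * inner a (\<zeta> * b)"
        by (simp add: power2_norm_eq_inner inner_add_left inner_add_right inner_commute)
      also have "inner a (\<zeta> * b) = t"
        by (simp add: inner_complex_def t_def p_def algebra_simps)
      finally show ?thesis using \<zeta> by (simp add: norm_mult B_def ss)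
    qed
    have t2: "2 * t\<^sup>2 = (cmod p)\<^sup>2 + Re (p\<^sup>2 * \<zeta>\<^sup>2)"
    proof -
      have "(cmod p)\<^sup>2 = (cmod (p * \<zeta>))\<^sup>2" using \<zeta> by (simp add: norm_mult)
      moreover have "2 * (Re q)\<^sup>2 = (cmod q)\<^sup>2 + Re (q\<^sup>2)" for q
        unfolding cmod_power2 by (simp add: power2_eq_square)
      ultimately show ?thesis
        unfolding power_mult_distrib[symmetric] t_def by metis
    qed
    have "18 * s ^ 3 * (s + (B + 2 * t) / (2 * s) - 2 * (B + 2 * t)\<^sup>2 / (9 * s ^ 3)
       - (s + B / (24 * s) + (1 / s - 8 * B / (9 * s ^ 3)) * t - 4 / (9 * s ^ 3) * Re (p\<^sup>2 * \<zeta>\<^sup>2)))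
       = 33 / 4 * s\<^sup>2 * B - 4 * B\<^sup>2 - 8 * (cmod p)\<^sup>2"
      using s t2 by (simp add: field_simps) algebra
    also have "\<dots> \<ge> 0"
    proof -
      have "B\<^sup>2 \<le> s\<^sup>2 / 16 * B" unfolding power2_eq_square[of B] using Bs B0 by (intro mult_right_mono)
      then show ?thesis using ps by simp
    qed
    finally have "s + B / (24 * s) + (1 / s - 8 * B / (9 * s ^ 3)) * t - 4 / (9 * s ^ 3) * Re (p\<^sup>2 * \<zeta>\<^sup>2)
       \<le> s + (B + 2 * t) / (2 * s) - 2 * (B + 2 * t)\<^sup>2 / (9 * s ^ 3)"
      using s by (simp add: zero_le_mult_iff)
    also have "\<dots> \<le> sqrt (s\<^sup>2 + (B + 2 * t))" by (rule sqrt_ge_quadratic[OF s u])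
    finally show ?thesis unfolding z
      by (simp add: t_def mult.assoc)
  qed
  then show ?thesis unfolding s_def[symmetric] B_def[symmetric] by blast
qed

lemma circle_mean_ereal:
  assumes "continuous_on {0..2 * pi} (\<lambda>\<theta>. f (a + cis \<theta> *\<^sub>C b))"
  shows "circle_mean (\<lambda>z. ereal (f z)) a b
    = ereal (1 / (2 * pi) * integral {0..2 * pi} (\<lambda>\<theta>. f (a + cis \<theta> *\<^sub>C b)))"
proof -
  let ?M = "restrict_space lborel {0..2 * pi}" and ?h = "\<lambda>\<theta>. f (a + cis \<theta> *\<^sub>C b)"
  have si: "set_integrable lborel {0..2 * pi} ?h"
    by (rule borel_integrable_atLeastAtMost'[OF assms])
  then have int: "integrable ?M ?h"
    by (simp add: set_integrable_def integrable_restrict_space)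
  have "integral\<^sup>L ?M ?h = integral {0..2 * pi} ?h"
    using set_borel_integral_eq_integral(2)[OF si]
    by (simp add: set_lebesgue_integral_def integral_restrict_space)
  moreover have "ereal_integral ?M (\<lambda>\<theta>. ereal (?h \<theta>)) = ereal (integral\<^sup>L ?M ?h)"
  proof -
    obtain p where p: "p \<ge> 0" "(\<integral>\<^sup>+x. ennreal (?h x) \<partial>?M) = ennreal p"
      using int by (auto simp: real_integrable_def less_top elim: ennreal_cases)
    obtain q where q: "q \<ge> 0" "(\<integral>\<^sup>+x. ennreal (- ?h x) \<partial>?M) = ennreal q"
      using int by (auto simp: real_integrable_def less_top elim: ennreal_cases)
    show ?thesis
      unfolding real_lebesgue_integral_def[OF int] ereal_integral_def
      using p q by (simp add: e2ennreal_ereal)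
  qed
  ultimately show ?thesis by (simp add: circle_mean_def)
qed

text \<open>The mean of \<open>Re (c \<zeta> + d \<zeta>\<^sup>2)\<close> over the unit circle vanishes.\<close>

lemma circle_mean_ge:
  assumes cont: "continuous_on {0..2 * pi} (\<lambda>\<theta>. f (a + cis \<theta> *\<^sub>C b))"
    and ge: "\<And>\<zeta>. cmod \<zeta> = 1 \<Longrightarrow> Q + Re (c * \<zeta> + d * \<zeta>\<^sup>2) \<le> f (a + \<zeta> *\<^sub>C b)"
  shows "ereal Q \<le> circle_mean (\<lambda>z. ereal (f z)) a b"
proof -
  \<comment> \<open>\<open>?P\<close> is an antiderivative of \<open>?p\<close>.\<close>
  let ?P = "\<lambda>\<theta>. Q * \<theta> + Re (c * cis \<theta> / \<i> + d * cis (2 * \<theta>) / (2 * \<i>))"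
  let ?p = "\<lambda>\<theta>. Q + Re (c * cis \<theta> + d * (cis \<theta>)\<^sup>2)"
  have "(?p has_integral (?P (2 * pi) - ?P 0)) {0..2 * pi}"
  proof (rule fundamental_theorem_of_calculus)
    fix x :: real
    have "cos (2 * x) = cos x * cos x - sin x * sin x" "sin (2 * x) = 2 * sin x * cos x"
      by (simp_all add: cos_double sin_double power2_eq_square)
    then have "?p x = Q + Re (c * cis x + d * cis (2 * x))"
      by (simp add: power2_eq_square)
    then show "(?P has_vector_derivative ?p x) (at x within {0..2 * pi})"
      unfolding has_real_derivative_iff_has_vector_derivative[symmetric]
      by (auto intro!: derivative_eq_intros simp: Re_divide Im_divide field_simps)
  qed simp
  moreover have "?P (2 * pi) - ?P 0 = 2 * pi * Q"
    using cis_multiple_2pi[of 2] by simp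
  ultimately have i: "(?p has_integral (2 * pi * Q)) {0..2 * pi}" by metis
  have "2 * pi * Q \<le> integral {0..2 * pi} (\<lambda>\<theta>. f (a + cis \<theta> *\<^sub>C b))"
    using i integrable_integral[OF integrable_continuous_interval[OF cont]]
    by (rule has_integral_le) (rule ge, simp)
  then show ?thesis
    unfolding circle_mean_ereal[OF cont] by (simp add: field_simps)
qed

section \<open>Smoothing a sum of moduli of linear functionals\<close>

definition smoothed_norm :: "(nat \<Rightarrow> cfin) \<Rightarrow> nat \<Rightarrow> real \<Rightarrow> cfin \<Rightarrow> real" where
  "smoothed_norm w n e z = (\<Sum>i<n. sqrt ((cmod (hpair z (w i)))\<^sup>2 + e\<^sup>2))"

text \<open>The gradient of \<open>smoothed_norm w n e\<close> for the real inner product, see \<open>C1_smoothed_norm\<close>.\<close>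

definition smoothed_gradient :: "(nat \<Rightarrow> cfin) \<Rightarrow> nat \<Rightarrow> real \<Rightarrow> cfin \<Rightarrow> cfin" where
  "smoothed_gradient w n e z =
     (\<Sum>i<n. (hpair z (w i) / of_real (sqrt ((cmod (hpair z (w i)))\<^sup>2 + e\<^sup>2))) *\<^sub>C w i)"

lemma smoothed_modulus_pos: "e > 0 \<Longrightarrow> 0 < sqrt ((cmod a)\<^sup>2 + e\<^sup>2)"
  by (intro real_sqrt_gt_zero add_nonneg_pos) auto

lemma has_derivative_smoothed_modulus:
  assumes "e > 0"
  shows "((\<lambda>z. sqrt ((cmod (hpair z w))\<^sup>2 + e\<^sup>2)) has_derivative
    (\<lambda>h. inner ((hpair z w / of_real (sqrt ((cmod (hpair z w))\<^sup>2 + e\<^sup>2))) *\<^sub>C w) h)) (at z within S)"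
proof -
  let ?s = "sqrt ((cmod (hpair z w))\<^sup>2 + e\<^sup>2)"
  have pos: "(cmod (hpair z w))\<^sup>2 + e\<^sup>2 > 0" using assms by (intro add_nonneg_pos) auto
  have l: "((\<lambda>z. hpair z w) has_derivative (\<lambda>h. hpair h w)) (at z within S)"
    by (rule bounded_linear.has_derivative[OF bounded_linear_hpair has_derivative_ident])
  have q: "((\<lambda>z. inner (hpair z w) (hpair z w) + e\<^sup>2) has_derivative
      (\<lambda>h. 2 * inner (hpair z w) (hpair h w))) (at z within S)"
    by (rule derivative_eq_intros l refl)+ (auto simp: inner_commute)
  have "((\<lambda>z. sqrt ((cmod (hpair z w))\<^sup>2 + e\<^sup>2)) has_derivative
      (\<lambda>h. 2 * inner (hpair z w) (hpair h w) * (inverse ?s / 2))) (at z within S)"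
    using has_derivative_real_sqrt[OF _ q] pos by (simp add: power2_norm_eq_inner)
  moreover have "inner ((hpair z w / of_real ?s) *\<^sub>C w) h = 2 * inner (hpair z w) (hpair h w) * (inverse ?s / 2)" for h
  proof -
    have "hpair z w / of_real ?s = inverse ?s *\<^sub>R hpair z w"
      by (simp add: scaleR_conv_of_real divide_inverse mult.commute)
    then show ?thesis by (simp only: inner_scaleC_hpair inner_scaleR_left) simp
  qed
  ultimately show ?thesis by simp
qed

lemma C1_smoothed_norm:
  assumes "e > 0" and w: "\<And>i. w i \<in> Cspace k"
  shows "C1_with_gradient k V (\<lambda>z. smoothed_norm w n e z - c) (smoothed_gradient w n e)"
  unfolding C1_with_gradient_def
proof (intro conjI ballI)
  fix z
  show "smoothed_gradient w n e z \<in> Cspace k"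
    unfolding smoothed_gradient_def by (intro Cspace_sum Cspace_scaleC w)
  have "(smoothed_norm w n e has_derivative
      (\<lambda>h. \<Sum>i<n. inner ((hpair z (w i) / of_real (sqrt ((cmod (hpair z (w i)))\<^sup>2 + e\<^sup>2))) *\<^sub>C w i) h)) (at z within Cspace k)"
    unfolding smoothed_norm_def by (intro has_derivative_sum has_derivative_smoothed_modulus assms)
  then show "((\<lambda>z. smoothed_norm w n e z - c) has_derivative inner (smoothed_gradient w n e z)) (at z within Cspace k)"
    unfolding smoothed_gradient_def inner_sum_left
    by (auto intro!: derivative_eq_intros)
next
  have "sqrt ((cmod a)\<^sup>2 + e\<^sup>2) \<noteq> 0" for a
    using smoothed_modulus_pos[OF assms(1), of a] by linarith
  then show "continuous_on V (smoothed_gradient w n e)"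
    unfolding smoothed_gradient_def
    by (intro continuous_on_sum bounded_linear.continuous_on[OF bounded_linear_scaleC_left]
       continuous_intros bounded_linear.continuous_on[OF bounded_linear_hpair]) (simp only: of_real_eq_0_iff not_False_eq_True ball_triv simp_thms)
qed

lemma smoothed_modulus_bounds:
  assumes "e > 0"
  shows "cmod a \<le> sqrt ((cmod a)\<^sup>2 + e\<^sup>2)" "sqrt ((cmod a)\<^sup>2 + e\<^sup>2) \<le> cmod a + e"
  using assms by (auto intro!: real_le_rsqrt real_le_lsqrt simp: power2_sum)

lemma smoothed_norm_bounds:
  assumes "e > 0"
  shows "(\<Sum>i<n. cmod (hpair z (w i))) \<le> smoothed_norm w n e z"
    "smoothed_norm w n e z \<le> (\<Sum>i<n. cmod (hpair z (w i))) + n * e"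
proof -
  show "(\<Sum>i<n. cmod (hpair z (w i))) \<le> smoothed_norm w n e z"
    unfolding smoothed_norm_def by (intro sum_mono smoothed_modulus_bounds assms)
  have "smoothed_norm w n e z \<le> (\<Sum>i<n. cmod (hpair z (w i)) + e)"
    unfolding smoothed_norm_def by (intro sum_mono smoothed_modulus_bounds assms)
  then show "smoothed_norm w n e z \<le> (\<Sum>i<n. cmod (hpair z (w i))) + n * e"
    by (simp add: sum.distrib)
qed

lemma norm_smoothed_gradient_le:
  assumes "e > 0"
  shows "norm (smoothed_gradient w n e z) \<le> (\<Sum>i<n. norm (w i))"
  unfolding smoothed_gradient_def
proof (rule sum_norm_le)
  fix i
  let ?a = "hpair z (w i)"
  have "cmod (?a / of_real (sqrt ((cmod ?a)\<^sup>2 + e\<^sup>2))) \<le> 1"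
    using smoothed_modulus_bounds(1)[OF assms, of ?a] smoothed_modulus_pos[OF assms, of ?a]
    by (simp add: norm_divide divide_le_eq_1)
  then show "norm ((?a / of_real (sqrt ((cmod ?a)\<^sup>2 + e\<^sup>2))) *\<^sub>C w i) \<le> norm (w i)"
    unfolding norm_scaleC by (intro mult_left_le_one_le) auto
qed

text \<open>A norm satisfies Euler's identity: its radial derivative at \<open>z\<close> is its value. For the smoothed
  norm this survives up to an error \<open>e\<close> per summand, because
  \<open>|a|\<^sup>2 / \<surd>(|a|\<^sup>2 + e\<^sup>2) \<ge> |a| - e\<close>. This is what keeps the gradients away from zero.\<close>

lemma inner_smoothed_gradient_ge:
  assumes e: "e > 0"
  shows "(\<Sum>i<n. cmod (hpair z (w i))) - n * e \<le> inner (smoothed_gradient w n e z) z"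
proof -
  have "cmod a - e \<le> inner (a / of_real (sqrt ((cmod a)\<^sup>2 + e\<^sup>2))) a" for a
  proof -
    let ?s = "sqrt ((cmod a)\<^sup>2 + e\<^sup>2)"
    have s: "?s > 0" "?s \<le> cmod a + e" "cmod a \<le> ?s" 
      using smoothed_modulus_pos[OF e] smoothed_modulus_bounds[OF e] by auto
    have "(cmod a - e) * ?s \<le> (cmod a)\<^sup>2"
    proof (cases "cmod a \<ge> e")
      case True
      then have "(cmod a - e) * ?s \<le> (cmod a - e) * (cmod a + e)" using s by (intro mult_left_mono) auto
      also have "\<dots> \<le> (cmod a)\<^sup>2" by (simp add: algebra_simps power2_eq_square)
      finally show ?thesis .
    next
      case False
      then have "(cmod a - e) * ?s \<le> 0" using s by (intro mult_nonpos_nonneg) auto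
      then show ?thesis using zero_le_power2[of "cmod a"] by linarith
    qed
    moreover have "a / of_real ?s = inverse ?s *\<^sub>R a"
      by (simp add: scaleR_conv_of_real divide_inverse mult.commute)
    then have "inner (a / of_real ?s) a = (cmod a)\<^sup>2 / ?s"
      by (simp only: inner_scaleR_left power2_norm_eq_inner) (simp add: divide_inverse)
    ultimately show ?thesis using s by (simp add: pos_le_divide_eq)
  qed
  then have "(\<Sum>i<n. cmod (hpair z (w i)) - e) \<le> inner (smoothed_gradient w n e z) z"
    unfolding smoothed_gradient_def inner_sum_left inner_scaleC_hpair by (intro sum_mono)
  then show ?thesis by (simp add: sum_subtractf)
qed

lemma smoothed_norm_ge_harmonic:
  assumes e: "e > 0" and b: "\<And>i. i < n \<Longrightarrow> cmod (hpair b (w i)) \<le> e / 4"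
  shows "\<exists>c d. \<forall>\<zeta>. cmod \<zeta> = 1 \<longrightarrow>
    smoothed_norm w n e a + (\<Sum>i<n. (cmod (hpair b (w i)))\<^sup>2 / (24 * sqrt ((cmod (hpair a (w i)))\<^sup>2 + e\<^sup>2)))
      + Re (c * \<zeta> + d * \<zeta>\<^sup>2) \<le> smoothed_norm w n e (a + \<zeta> *\<^sub>C b)"
proof -
  have "\<exists>c d. i < n \<longrightarrow> (\<forall>\<zeta>. cmod \<zeta> = 1 \<longrightarrow>
    sqrt ((cmod (hpair a (w i)))\<^sup>2 + e\<^sup>2)
      + (cmod (hpair b (w i)))\<^sup>2 / (24 * sqrt ((cmod (hpair a (w i)))\<^sup>2 + e\<^sup>2)) + Re (c * \<zeta> + d * \<zeta>\<^sup>2)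
      \<le> sqrt ((cmod (hpair (a + \<zeta> *\<^sub>C b) (w i)))\<^sup>2 + e\<^sup>2))" for i
    using smoothed_modulus_ge_harmonic[OF e b, of i "hpair a (w i)"]
    unfolding hpair_add hpair_scaleC by blast
  then obtain c d where cd: "\<And>i \<zeta>. i < n \<Longrightarrow> cmod \<zeta> = 1 \<Longrightarrow>
    sqrt ((cmod (hpair a (w i)))\<^sup>2 + e\<^sup>2)
      + (cmod (hpair b (w i)))\<^sup>2 / (24 * sqrt ((cmod (hpair a (w i)))\<^sup>2 + e\<^sup>2)) + Re (c i * \<zeta> + d i * \<zeta>\<^sup>2)
      \<le> sqrt ((cmod (hpair (a + \<zeta> *\<^sub>C b) (w i)))\<^sup>2 + e\<^sup>2)"
    by metis
  have "smoothed_norm w n e a + (\<Sum>i<n. (cmod (hpair b (w i)))\<^sup>2 / (24 * sqrt ((cmod (hpair a (w i)))\<^sup>2 + e\<^sup>2)))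
      + Re ((\<Sum>i<n. c i) * \<zeta> + (\<Sum>i<n. d i) * \<zeta>\<^sup>2) \<le> smoothed_norm w n e (a + \<zeta> *\<^sub>C b)"
    if "cmod \<zeta> = 1" for \<zeta>
    unfolding smoothed_norm_def sum_distrib_right sum.distrib[symmetric] Re_sum
    by (intro sum_mono cd that) auto
  then show ?thesis by blast
qed

section \<open>Norms given by a summable family of functionals\<close>

text \<open>A family of functionals of this kind is an injective linear map \<open>\<complex>\<^sup>k \<rightarrow> \<ell>\<^sub>1\<close>, written in
  coordinates: \<open>z\<close> goes to the sequence \<open>hpair z (w i)\<close>. Summability of the norms of the
  functionals is stronger than summability of that sequence for each \<open>z\<close>, and
  makes all tail estimates uniform on bounded sets.\<close>

locale summable_functionals =
  fixes k :: nat and w :: "nat \<Rightarrow> cfin"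
  assumes in_Cspace: "w i \<in> Cspace k"
    and summable_norm: "summable (\<lambda>i. norm (w i))"
    and separating: "z \<in> Cspace k \<Longrightarrow> (\<And>i. hpair z (w i) = 0) \<Longrightarrow> z = 0"
begin

definition pullback_norm :: "cfin \<Rightarrow> real" where
  "pullback_norm z = (\<Sum>i. cmod (hpair z (w i)))"

text \<open>A bound for the operator norm of the map into \<open>\<ell>\<^sub>1\<close>; the summand \<open>1\<close> makes it positive
  also when all functionals vanish.\<close>

definition op_bound :: real where
  "op_bound = 1 + (\<Sum>i. norm (w i))"

lemma op_bound_pos: "op_bound > 0"
  using suminf_nonneg[OF summable_norm] by (simp add: op_bound_def)

lemma sum_norm_le: "(\<Sum>i<n. norm (w i)) \<le> op_bound"
  using sum_le_suminf[OF summable_norm, of "{..<n}"] by (simp add: op_bound_def)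

lemma norm_le_op_bound: "norm (w i) \<le> op_bound"
  using sum_le_suminf[OF summable_norm, of "{i}"] by (simp add: op_bound_def)

lemma summable_hpair: "summable (\<lambda>i. cmod (hpair z (w i)))"
  by (rule summable_comparison_test'[OF summable_mult2[OF summable_norm, of "norm z"], of 0])
    (simp add: cmod_hpair_le)

lemma cmod_hpair_le_pullback_norm: "cmod (hpair z (w i)) \<le> pullback_norm z"
  using sum_le_suminf[OF summable_hpair, of "{i}" z] by (simp add: pullback_norm_def)

lemma pullback_norm_nonneg: "pullback_norm z \<ge> 0"
  unfolding pullback_norm_def by (intro suminf_nonneg summable_hpair) auto

lemma pullback_norm_tail:
  "pullback_norm z \<le> (\<Sum>i<n. cmod (hpair z (w i))) + (\<Sum>i. norm (w (i + n))) * norm z"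
proof -
  have sm: "summable (\<lambda>i. norm (w (i + n)))"
    by (rule summable_ignore_initial_segment[OF summable_norm])
  have "pullback_norm z = (\<Sum>i. cmod (hpair z (w (i + n)))) + (\<Sum>i<n. cmod (hpair z (w i)))"
    unfolding pullback_norm_def by (rule suminf_split_initial_segment[OF summable_hpair])
  also have "(\<Sum>i. cmod (hpair z (w (i + n)))) \<le> (\<Sum>i. norm (w (i + n)) * norm z)"
  proof (rule suminf_le)
    show "summable (\<lambda>i. cmod (hpair z (w (i + n))))"
      by (rule summable_ignore_initial_segment[OF summable_hpair])
  qed (use cmod_hpair_le sm in \<open>auto intro: summable_mult2\<close>)
  also have "\<dots> = (\<Sum>i. norm (w (i + n))) * norm z" by (rule suminf_mult2[symmetric, OF sm])
  finally show ?thesis by simp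
qed

lemma pullback_norm_le: "pullback_norm z \<le> op_bound * norm z"
  using pullback_norm_tail[of z 0] by (simp add: op_bound_def distrib_right add_increasing)

lemma pullback_norm_triangle: "pullback_norm (x + y) \<le> pullback_norm x + pullback_norm y"
  unfolding pullback_norm_def suminf_add[OF summable_hpair summable_hpair]
  by (intro suminf_le summable_add summable_hpair) (simp add: hpair_add norm_triangle_ineq)

lemma pullback_norm_scaleC: "pullback_norm (c *\<^sub>C z) = cmod c * pullback_norm z"
  by (simp add: pullback_norm_def hpair_scaleC norm_mult suminf_mult summable_hpair)

lemma continuous_on_pullback_norm: "continuous_on S pullback_norm"
proof -
  have "\<bar>pullback_norm x - pullback_norm y\<bar> \<le> op_bound * norm (x - y)" for x y
    using pullback_norm_triangle[of "x - y" y] pullback_norm_triangle[of "y - x" x]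
      pullback_norm_le[of "x - y"] pullback_norm_le[of "y - x"]
    by (simp add: norm_minus_commute abs_le_iff)
  then have "op_bound-lipschitz_on S pullback_norm"
    using op_bound_pos by (intro lipschitz_onI) (simp_all add: dist_norm)
  then show ?thesis by (rule lipschitz_on_continuous_on)
qed

text \<open>Any two norms on \<open>\<complex>\<^sup>k\<close> are equivalent: the continuous function \<open>pullback_norm\<close> attains a
  minimum on the compact unit sphere, and this is positive since the functionals separate points.\<close>

lemma norm_le_pullback_norm: "\<exists>C>0. \<forall>z\<in>Cspace k. norm z \<le> C * pullback_norm z"
proof (cases "Cspace k \<inter> sphere 0 1 = {}")
  case True
  have "z = 0" if z: "z \<in> Cspace k" for z
  proof (rule ccontr)
    assume "z \<noteq> 0"
    then have "of_real (inverse (norm z)) *\<^sub>C z \<in> Cspace k \<inter> sphere 0 1"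
      using z by (simp add: Cspace_scaleC norm_scaleC norm_inverse)
    then show False using True by blast
  qed
  then have "norm z \<le> 1 * pullback_norm z" if "z \<in> Cspace k" for z
    using that pullback_norm_nonneg[of z] by fastforce
  then show ?thesis by (intro exI[of _ 1]) auto
next
  case False
  have "compact (Cspace k \<inter> sphere 0 1)"
    by (rule compact_Cspace) (auto simp: bounded_iff sphere_def intro!: closed_Collect_eq continuous_intros)
  then obtain p where p: "p \<in> Cspace k" "norm p = 1"
    and min: "\<And>z. z \<in> Cspace k \<Longrightarrow> norm z = 1 \<Longrightarrow> pullback_norm p \<le> pullback_norm z"
    using continuous_attains_inf[OF _ False continuous_on_pullback_norm] by auto
  have "pullback_norm p \<noteq> 0"
  proof
    assume "pullback_norm p = 0"
    then have "hpair p (w i) = 0" for i using cmod_hpair_le_pullback_norm[of p i] by simp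
    then have "p = 0" using separating[OF p(1)] by blast
    then show False using p(2) by simp
  qed
  then have pos: "pullback_norm p > 0" using pullback_norm_nonneg[of p] by simp
  have "norm z \<le> inverse (pullback_norm p) * pullback_norm z" if z: "z \<in> Cspace k" for z
  proof (cases "z = 0")
    case False
    have "pullback_norm p \<le> pullback_norm (of_real (inverse (norm z)) *\<^sub>C z)"
      using z False by (intro min) (simp_all add: Cspace_scaleC norm_scaleC norm_inverse)
    also have "\<dots> = inverse (norm z) * pullback_norm z"
      by (simp only: pullback_norm_scaleC norm_of_real) simp
    finally show ?thesis using False pos by (simp add: field_simps)
  qed (simp add: pullback_norm_nonneg pos less_imp_le)
  then show ?thesis using pos by (intro exI[of _ "inverse (pullback_norm p)"]) auto
qed

lemma tail_tendsto_0: "(\<lambda>n. \<Sum>i. norm (w (i + n))) \<longlonglongrightarrow> 0"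
  using suminf_exist_split2[OF summable_norm] by simp

text \<open>Strictness of the plurisubharmonicity in all directions at once: since the tail of the pullback
  norm is at most half of it, finitely many functionals already dominate the Euclidean norm, and
  Cauchy--Schwarz passes to squares. The constant \<open>L\<close> does not depend on the number \<open>n\<close> of
  functionals, so it serves all approximants.\<close>

lemma finitely_many_functionals_suffice:
  "\<exists>N L. 0 < L \<and> (\<forall>n\<ge>N. \<forall>z\<in>Cspace k. L * (norm z)\<^sup>2 \<le> (\<Sum>i<n. (cmod (hpair z (w i)))\<^sup>2))"
proof -
  obtain C where C: "C > 0" "\<And>z. z \<in> Cspace k \<Longrightarrow> norm z \<le> C * pullback_norm z"
    using norm_le_pullback_norm by blast
  have "\<forall>\<^sub>F n in sequentially. (\<Sum>i. norm (w (i + n))) < 1 / (2 * C)"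
    using tail_tendsto_0 C(1) by (intro order_tendstoD) auto
  then obtain N where N: "\<And>n. n \<ge> N \<Longrightarrow> (\<Sum>i. norm (w (i + n))) < 1 / (2 * C)"
    by (auto simp: eventually_sequentially)
  define P where "P = real (Suc N)"
  have P: "P > 0" "real N \<le> P" by (simp_all add: P_def)
  have "1 / (4 * C\<^sup>2 * P) * (norm z)\<^sup>2 \<le> (\<Sum>i<n. (cmod (hpair z (w i)))\<^sup>2)"
    if z: "z \<in> Cspace k" and n: "n \<ge> N" for n z
  proof -
    let ?S = "\<Sum>i<N. cmod (hpair z (w i))"
    have "norm z \<le> C * (?S + 1 / (2 * C) * norm z)"
      using pullback_norm_tail[of z N] C(1)
        mult_right_mono[OF less_imp_le[OF N[OF order_refl]] norm_ge_zero[of z]]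
      by (intro order_trans[OF C(2)[OF z]] mult_left_mono) auto
    then have "norm z \<le> 2 * C * ?S" using C(1) by (simp add: field_simps)
    then have "(norm z)\<^sup>2 \<le> (2 * C * ?S)\<^sup>2" by (intro power_mono) auto
    also have "\<dots> = 4 * C\<^sup>2 * ?S\<^sup>2" by (simp add: power_mult_distrib)
    also have "\<dots> \<le> 4 * C\<^sup>2 * (P * (\<Sum>i<N. (cmod (hpair z (w i)))\<^sup>2))"
    proof (intro mult_left_mono)
      have "?S\<^sup>2 \<le> real N * (\<Sum>i<N. (cmod (hpair z (w i)))\<^sup>2)"
        using sum_squared_le_sum_of_squares[of "\<lambda>i. cmod (hpair z (w i))" "{..<N}"] by (simp add: mult.commute)
      also have "\<dots> \<le> P * (\<Sum>i<N. (cmod (hpair z (w i)))\<^sup>2)"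
        using P by (intro mult_right_mono sum_nonneg) auto
      finally show "?S\<^sup>2 \<le> P * (\<Sum>i<N. (cmod (hpair z (w i)))\<^sup>2)" .
    qed auto
    finally have "1 / (4 * C\<^sup>2 * P) * (norm z)\<^sup>2 \<le> (\<Sum>i<N. (cmod (hpair z (w i)))\<^sup>2)"
      using C(1) P by (simp add: field_simps)
    also have "\<dots> \<le> (\<Sum>i<n. (cmod (hpair z (w i)))\<^sup>2)" using n by (intro sum_mono2) auto
    finally show ?thesis .
  qed
  moreover have "0 < 1 / (4 * C\<^sup>2 * P)" using C(1) P by simp
  ultimately show ?thesis by blast
qed

text \<open>The constant \<open>96\<close> is \<open>24 \<sqdot> 4\<close>: where the pullback norm is below \<open>3\<close> and \<open>e \<le> 1\<close>, every root
  \<open>\<surd>(|hpair a (w i)|\<^sup>2 + e\<^sup>2)\<close> is at most \<open>4\<close>.\<close>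

lemma unif_psh_smoothed_norm:
  assumes e: "0 < e" "e \<le> 1" and L: "0 < L"
    and low: "\<And>b. b \<in> Cspace k \<Longrightarrow> L * (norm b)\<^sup>2 \<le> (\<Sum>i<n. (cmod (hpair b (w i)))\<^sup>2)"
  shows "unif_psh_on_average (L / 96) (Cspace k) {z \<in> Cspace k. pullback_norm z < 3}
    (\<lambda>z. ereal (smoothed_norm w n e z - 1))"
proof -
  let ?V = "{z \<in> Cspace k. pullback_norm z < 3}"
  let ?r = "\<lambda>z. smoothed_norm w n e z - 1"
  have cont: "continuous_on S ?r" for S
    unfolding smoothed_norm_def
    by (intro continuous_intros bounded_linear.continuous_on[OF bounded_linear_hpair])
  \<comment> \<open>The first bound keeps the disc inside the domain; the second makes every
    \<open>|hpair b (w i)|\<close> at most \<open>e / 4\<close>, as \<open>smoothed_norm_ge_harmonic\<close> demands.\<close>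
  define \<delta> where "\<delta> a = min ((3 - pullback_norm a) / op_bound) (e / (4 * op_bound))" for a
  have "openin (top_of_set (Cspace k)) (Cspace k \<inter> pullback_norm -` {..<3})"
    by (rule continuous_openin_preimage_gen[OF continuous_on_pullback_norm]) simp
  moreover have "Cspace k \<inter> pullback_norm -` {..<3} = ?V" by auto
  ultimately have op: "openin (top_of_set (Cspace k)) ?V" by simp
  have usc: "upper_semicontinuous_on ?V (\<lambda>z. ereal (?r z))"
    unfolding upper_semicontinuous_on_def
  proof
    fix c
    have "openin (top_of_set ?V) (?V \<inter> (\<lambda>z. ereal (?r z)) -` {..<c})"
      by (rule continuous_openin_preimage_gen[OF continuous_on_ereal[OF cont]]) simp
    moreover have "?V \<inter> (\<lambda>z. ereal (?r z)) -` {..<c} = {z \<in> ?V. ereal (?r z) < c}" by auto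
    ultimately show "openin (top_of_set ?V) {z \<in> ?V. ereal (?r z) < c}" by simp
  qed
  have lsc: "lower_semicontinuous_on ?V \<delta>"
    unfolding lower_semicontinuous_on_def
  proof
    fix c
    have "continuous_on ?V \<delta>"
      unfolding \<delta>_def using op_bound_pos by (intro continuous_intros continuous_on_pullback_norm) auto
    then have "openin (top_of_set ?V) (?V \<inter> \<delta> -` {c<..})"
      by (rule continuous_openin_preimage_gen) simp
    moreover have "?V \<inter> \<delta> -` {c<..} = {z \<in> ?V. c < \<delta> z}" by auto
    ultimately show "openin (top_of_set ?V) {z \<in> ?V. c < \<delta> z}" by simp
  qed
  have pos: "0 < \<delta> a" if "a \<in> ?V" for a
    using that op_bound_pos e by (simp add: \<delta>_def)
  have main: "(\<forall>\<zeta>. cmod \<zeta> \<le> 1 \<longrightarrow> a + \<zeta> *\<^sub>C b \<in> ?V) \<and>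
     ereal (L / 96 * (norm b)\<^sup>2) + ereal (?r a) \<le> circle_mean (\<lambda>z. ereal (?r z)) a b"
    if a: "a \<in> ?V" and b: "b \<in> Cspace k" and bd: "norm b < \<delta> a" for a b
  proof
    have b1: "op_bound * norm b < 3 - pullback_norm a" and b2: "op_bound * norm b < e / 4"
      using bd op_bound_pos by (simp_all add: \<delta>_def field_simps)
    show "\<forall>\<zeta>. cmod \<zeta> \<le> 1 \<longrightarrow> a + \<zeta> *\<^sub>C b \<in> ?V"
    proof (intro allI impI)
      fix \<zeta> :: complex assume z: "cmod \<zeta> \<le> 1"
      have "pullback_norm (a + \<zeta> *\<^sub>C b) \<le> pullback_norm a + cmod \<zeta> * pullback_norm b"
        using pullback_norm_triangle[of a "\<zeta> *\<^sub>C b"] by (simp add: pullback_norm_scaleC)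
      also have "\<dots> \<le> pullback_norm a + op_bound * norm b"
        using mult_left_le_one_le[OF pullback_norm_nonneg[of b] norm_ge_zero z] pullback_norm_le[of b] by linarith
      finally show "a + \<zeta> *\<^sub>C b \<in> ?V" using a b b1 by (simp add: Cspace_add Cspace_scaleC)
    qed
    have "cmod (hpair b (w i)) \<le> e / 4" for i
      using cmod_hpair_le[of b "w i"] mult_right_mono[OF norm_le_op_bound[of i] norm_ge_zero[of b]] b2 by linarith
    then obtain c d where cd: "\<And>\<zeta>. cmod \<zeta> = 1 \<Longrightarrow>
      smoothed_norm w n e a + (\<Sum>i<n. (cmod (hpair b (w i)))\<^sup>2 / (24 * sqrt ((cmod (hpair a (w i)))\<^sup>2 + e\<^sup>2)))
        + Re (c * \<zeta> + d * \<zeta>\<^sup>2) \<le> smoothed_norm w n e (a + \<zeta> *\<^sub>C b)"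
      using smoothed_norm_ge_harmonic[OF e(1), of n b w a] by blast
    have "L / 96 * (norm b)\<^sup>2 \<le> (\<Sum>i<n. (cmod (hpair b (w i)))\<^sup>2 / 96)"
      using low[OF b] by (simp add: sum_divide_distrib[symmetric])
    also have "\<dots> \<le> (\<Sum>i<n. (cmod (hpair b (w i)))\<^sup>2 / (24 * sqrt ((cmod (hpair a (w i)))\<^sup>2 + e\<^sup>2)))"
    proof (intro sum_mono divide_left_mono)
      fix i
      show "24 * sqrt ((cmod (hpair a (w i)))\<^sup>2 + e\<^sup>2) \<le> 96"
        using smoothed_modulus_bounds(2)[OF e(1), of "hpair a (w i)"] cmod_hpair_le_pullback_norm[of a i] a e by simp
      show "0 < 96 * (24 * sqrt ((cmod (hpair a (w i)))\<^sup>2 + e\<^sup>2))"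
        using smoothed_modulus_pos[OF e(1)] by simp
    qed auto
    finally have Q: "L / 96 * (norm b)\<^sup>2 \<le> \<dots>" .
    have "ereal (L / 96 * (norm b)\<^sup>2 + ?r a) \<le> circle_mean (\<lambda>z. ereal (?r z)) a b"
    proof (rule circle_mean_ge)
      have "continuous_on {0..2 * pi} (\<lambda>\<theta>. a + cis \<theta> *\<^sub>C b)"
        by (intro continuous_intros bounded_linear.continuous_on[OF bounded_linear_scaleC_left])
      then show "continuous_on {0..2 * pi} (\<lambda>\<theta>. ?r (a + cis \<theta> *\<^sub>C b))"
        by (rule continuous_on_compose2[OF cont[of UNIV]]) auto
      show "L / 96 * (norm b)\<^sup>2 + ?r a + Re (c * \<zeta> + d * \<zeta>\<^sup>2) \<le> ?r (a + \<zeta> *\<^sub>C b)" if "cmod \<zeta> = 1" for \<zeta>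
        using cd[OF that] Q by linarith
    qed
    then show "ereal (L / 96 * (norm b)\<^sup>2) + ereal (?r a) \<le> circle_mean (\<lambda>z. ereal (?r z)) a b" by simp
  qed
  show ?thesis
    unfolding unif_psh_on_average_def
    using L op usc lsc pos main by auto
qed

text \<open>The defining function is \<open>pullback_norm - 1\<close>, approximated by smoothed partial sums whose
  number \<open>n j\<close> of terms tends to infinity while the total smoothing error \<open>n j * e j\<close> tends to \<open>0\<close>.
  On the shell \<open>1/2 \<le> pullback_norm \<le> 2\<close> the radial derivative of an approximant is at least
  \<open>1/2 - 1/8 - 1/8\<close>, the two losses being the tail of the series and the smoothing error; this
  bounds the gradients from below, uniformly in \<open>j\<close>.\<close>

lemma zero_unif_pseudoconvex_pullback_ball:
  "zero_unif_pseudoconvex k {z \<in> Cspace k. pullback_norm z < 1}"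
proof -
  let ?X = "top_of_set (Cspace k)"
  let ?U = "{z \<in> Cspace k. pullback_norm z < 1}"
  define V1 where "V1 = {z \<in> Cspace k. 1 / 2 < pullback_norm z \<and> pullback_norm z < 2}"
  define V2 where "V2 = {z \<in> Cspace k. pullback_norm z < 3}"
  have op: "openin ?X {z \<in> Cspace k. pullback_norm z \<in> T}" if "open T" for T
  proof -
    have "{z \<in> Cspace k. pullback_norm z \<in> T} = Cspace k \<inter> pullback_norm -` T" by auto
    then show ?thesis
      using continuous_openin_preimage_gen[OF continuous_on_pullback_norm that] by simp
  qed
  have cl: "?X closure_of {z \<in> Cspace k. pullback_norm z \<in> S} \<subseteq> {z \<in> Cspace k. pullback_norm z \<in> T}"
    if "closed T" "S \<subseteq> T" for S T
  proof (rule closure_of_minimal)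
    have "{z \<in> Cspace k. pullback_norm z \<in> T} = Cspace k \<inter> pullback_norm -` T" by auto
    then show "closedin ?X {z \<in> Cspace k. pullback_norm z \<in> T}"
      using continuous_closedin_preimage[OF continuous_on_pullback_norm that(1)] by simp
  qed (use that in auto)
  obtain C where C: "C > 0" "\<And>z. z \<in> Cspace k \<Longrightarrow> norm z \<le> C * pullback_norm z"
    using norm_le_pullback_norm by blast
  have bdd: "bounded {z \<in> Cspace k. pullback_norm z \<in> S}" if "S \<subseteq> {..3}" for S
    unfolding bounded_iff
  proof (intro exI[of _ "C * 3"] ballI)
    fix z assume z: "z \<in> {z \<in> Cspace k. pullback_norm z \<in> S}"
    then have "C * pullback_norm z \<le> C * 3" using C(1) that by (intro mult_left_mono) auto
    then show "norm z \<le> C * 3" using C(2)[of z] z by auto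
  qed
  have U: "?U = {z \<in> Cspace k. pullback_norm z \<in> {..<1}}" by auto
  have V1: "V1 = {z \<in> Cspace k. pullback_norm z \<in> {1/2<..<2}}" by (auto simp: V1_def)
  have V2: "V2 = {z \<in> Cspace k. pullback_norm z \<in> {..<3}}" by (auto simp: V2_def)
  have clU: "?X closure_of ?U \<subseteq> {z \<in> Cspace k. pullback_norm z \<in> {..1}}"
    unfolding U by (rule cl) auto
  have clV1: "?X closure_of V1 \<subseteq> {z \<in> Cspace k. pullback_norm z \<in> {1/2..2}}"
    unfolding V1 by (rule cl) auto
  have opU: "openin ?X ?U" unfolding U by (rule op) simp
  have compU: "compact (?X closure_of ?U)"
  proof -
    have "closedin ?X (?X closure_of ?U)" by simp
    then have "closed (?X closure_of ?U)"
      using closed_Cspace closedin_closed_eq by blast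
    moreover have "bounded (?X closure_of ?U)"
      by (rule bounded_subset[OF bdd clU]) auto
    moreover have "?X closure_of ?U = Cspace k \<inter> ?X closure_of ?U" using clU by auto
    ultimately show ?thesis using compact_Cspace by metis
  qed
  have frU: "?X frontier_of ?U \<subseteq> V1"
  proof
    fix z assume z: "z \<in> ?X frontier_of ?U"
    then have "z \<in> ?X closure_of ?U" "z \<notin> ?U"
      using opU by (auto simp: frontier_of_def interior_of_openin)
    then show "z \<in> V1" using clU by (auto simp: V1_def)
  qed
  obtain N0 L where L: "0 < L"
    and low: "\<And>n z. n \<ge> N0 \<Longrightarrow> z \<in> Cspace k \<Longrightarrow> L * (norm z)\<^sup>2 \<le> (\<Sum>i<n. (cmod (hpair z (w i)))\<^sup>2)"
    using finitely_many_functionals_suffice by blast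
  have "\<forall>\<^sub>F n in sequentially. (\<Sum>i. norm (w (i + n))) < 1 / (16 * C)"
    using tail_tendsto_0 C(1) by (intro order_tendstoD) auto
  then obtain N1 where N1: "\<And>n. n \<ge> N1 \<Longrightarrow> (\<Sum>i. norm (w (i + n))) < 1 / (16 * C)"
    by (auto simp: eventually_sequentially)
  \<comment> \<open>From \<open>N0\<close> functionals on, the smoothed norms are uniformly plurisubharmonic; from \<open>N1\<close> on,
    the neglected tail is at most \<open>1/8\<close> on the shell. The square in \<open>e\<close> makes \<open>n j * e j\<close> small.\<close>
  define n where "n j = j + N0 + N1" for j
  define e where "e j = 1 / (8 * (real (n j) + 1)\<^sup>2)" for j
  have n: "n j \<ge> N0" "n j \<ge> N1" for j by (auto simp: n_def)
  have e: "0 < e j" "e j \<le> 1" for j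
  proof -
    have "1 \<le> (real (n j) + 1)\<^sup>2" by (intro one_le_power) auto
    then have "1 \<le> 8 * (real (n j) + 1)\<^sup>2" by linarith
    then show "0 < e j" "e j \<le> 1" by (simp_all add: e_def)
  qed
  have ne: "n j * e j \<le> 1 / (8 * (real j + 1))" for j
  proof -
    have "n j * e j \<le> (real (n j) + 1) * e j"
      using e(1)[of j] by (intro mult_right_mono) auto
    also have "\<dots> = 1 / (8 * (real (n j) + 1))"
      by (simp add: e_def power2_eq_square)
    also have "\<dots> \<le> 1 / (8 * (real j + 1))"
      by (intro divide_left_mono) (auto simp: n_def)
    finally show ?thesis .
  qed
  have ne8: "n j * e j \<le> 1 / 8" for j
    by (rule order_trans[OF ne]) (simp add: divide_simps)
  define rs where "rs j z = smoothed_norm w (n j) (e j) z - 1" for j z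
  define G where "G j = smoothed_gradient w (n j) (e j)" for j
  have lim: "(\<lambda>j. rs j z) \<longlonglongrightarrow> pullback_norm z - 1" for z
  proof -
    have "(\<lambda>m. \<Sum>i<m. cmod (hpair z (w i))) \<longlonglongrightarrow> pullback_norm z"
      unfolding pullback_norm_def by (rule summable_LIMSEQ[OF summable_hpair])
    then have s: "(\<lambda>j. \<Sum>i<n j. cmod (hpair z (w i))) \<longlonglongrightarrow> pullback_norm z"
      unfolding n_def add.assoc by (rule LIMSEQ_ignore_initial_segment)
    have "(\<lambda>j. 1 / (8 * (real j + 1))) \<longlonglongrightarrow> 0" by real_asymp
    then have "(\<lambda>j. (\<Sum>i<n j. cmod (hpair z (w i))) + 1 / (8 * (real j + 1))) \<longlonglongrightarrow> pullback_norm z"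
      using tendsto_add[OF s] by fastforce
    then have "(\<lambda>j. smoothed_norm w (n j) (e j) z) \<longlonglongrightarrow> pullback_norm z"
    proof (rule tendsto_sandwich[OF _ _ s, rotated 2])
      show "\<forall>\<^sub>F j in sequentially. (\<Sum>i<n j. cmod (hpair z (w i))) \<le> smoothed_norm w (n j) (e j) z"
        using smoothed_norm_bounds(1)[OF e(1)] by simp
      show "\<forall>\<^sub>F j in sequentially. smoothed_norm w (n j) (e j) z \<le> (\<Sum>i<n j. cmod (hpair z (w i))) + 1 / (8 * (real j + 1))"
        using order_trans[OF smoothed_norm_bounds(2)[OF e(1)] add_left_mono[OF ne]] by simp
    qed
    then show ?thesis unfolding rs_def by (intro tendsto_intros)
  qed
  have grad: "1 / (8 * C) \<le> norm (G j z) \<and> norm (G j z) \<le> op_bound"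
    if "z \<in> ?X closure_of V1" for j z
  proof
    have z: "z \<in> Cspace k" "1 / 2 \<le> pullback_norm z" "pullback_norm z \<le> 2" using that clV1 by auto
    have "C * pullback_norm z \<le> C * 2" using C(1) z by (intro mult_left_mono) auto
    then have nz: "norm z \<le> 2 * C" using C(2)[OF z(1)] by simp
    have "(\<Sum>i. norm (w (i + n j))) * norm z \<le> 1 / (16 * C) * (2 * C)"
      using less_imp_le[OF N1[OF n(2)]] nz C(1) by (intro mult_mono) auto
    also have "\<dots> = 1 / 8" using C(1) by simp
    finally have "3 / 8 \<le> (\<Sum>i<n j. cmod (hpair z (w i)))"
      using pullback_norm_tail[of z "n j"] z(2) by linarith
    then have "1 / 4 \<le> inner (G j z) z"
      using inner_smoothed_gradient_ge[OF e(1), of z w "n j" j] ne8[of j] unfolding G_def by linarith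
    also have "\<dots> \<le> norm (G j z) * norm z" by (rule norm_cauchy_schwarz)
    also have "\<dots> \<le> norm (G j z) * (2 * C)" using nz by (intro mult_left_mono) auto
    finally show "1 / (8 * C) \<le> norm (G j z)" using C(1) by (simp add: field_simps)
    show "norm (G j z) \<le> op_bound"
      unfolding G_def by (rule order_trans[OF norm_smoothed_gradient_le[OF e(1)] sum_norm_le])
  qed
  show ?thesis
    unfolding zero_unif_pseudoconvex_def
  proof (rule conjI[OF opU conjI[OF compU]], rule exI[of _ "L / 96"], rule exI[of _ "1 / (8 * C)"],
      rule exI[of _ op_bound], rule exI[of _ V1], rule exI[of _ V2],
      rule exI[of _ "\<lambda>z. pullback_norm z - 1"], rule exI[of _ rs], rule exI[of _ G],
      intro conjI ballI allI)
    show "openin ?X V1" "openin ?X V2" unfolding V1 V2 by (rule op, simp)+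
    show "bounded V1" "bounded V2" unfolding V1 V2 by (rule bdd, force)+
    show "?X closure_of V1 \<subseteq> V2" using clV1 by (auto simp: V2_def)
    show "?U \<inter> V2 = {z \<in> V2. pullback_norm z - 1 < 0}" by (auto simp: V2_def)
    show "bounded (range (\<lambda>j. rs j z))" for z
      by (rule convergent_imp_bounded[OF lim])
    show "C1_with_gradient k V2 (rs j) (G j)" for j
      unfolding rs_def G_def by (rule C1_smoothed_norm[OF e(1) in_Cspace])
    show "unif_psh_on_average (L / 96) (Cspace k) V2 (\<lambda>z. ereal (rs j z))" for j
      unfolding rs_def V2_def by (rule unif_psh_smoothed_norm[OF e L low[OF n(1)]])
  qed (use frU lim grad L C(1) op_bound_pos in auto)
qed

end

section \<open>Finite-dimensional sections of the ball of \<open>\<ell>\<^sub>1\<close>\<close>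

text \<open>The functional \<open>w i\<close> represents the \<open>i\<close>-th coordinate of \<open>\<phi>\<close>. Its norm is at most the sum
  over \<open>j < k\<close> of the moduli of the \<open>i\<close>-th coordinates of \<open>\<phi> (basis_vec j)\<close>, and summing over
  \<open>i\<close> gives the finite number \<open>\<Sum>j<k. norm (\<phi> (basis_vec j))\<close>: this is where finite dimension
  and the \<open>\<ell>\<^sub>1\<close>-norm together yield summability.\<close>

lemma summable_functionals_into_ell1:
  fixes \<phi> :: "cfin \<Rightarrow> ell1"
  assumes lin: "Vector_Spaces.linear scaleC scaleC \<phi>" and inj: "inj_on \<phi> (Cspace k)"
  obtains w where "summable_functionals k w"
    "\<And>z i. z \<in> Cspace k \<Longrightarrow> hpair z (w i) = ell1_nth (\<phi> z) i"
proof -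
  interpret Vector_Spaces.linear scaleC scaleC \<phi> by (rule lin)
  define w where "w i = Abs_cfin (\<lambda>j. if j < k then cnj (ell1_nth (\<phi> (basis_vec j)) i) else 0)" for i
  have cw: "coord (w i) j = (if j < k then cnj (ell1_nth (\<phi> (basis_vec j)) i) else 0)" for i j
  proof -
    have "finite {j. (if j < k then cnj (ell1_nth (\<phi> (basis_vec j)) i) else 0) \<noteq> 0}"
      by (rule finite_subset[of _ "{..<k}"]) auto
    then show ?thesis by (simp add: w_def Abs_cfin_inverse)
  qed
  have wC: "w i \<in> Cspace k" for i by (simp add: Cspace_def cw)
  have nth_sum: "ell1_nth (sum f A) i = (\<Sum>a\<in>A. ell1_nth (f a) i)" for f :: "nat \<Rightarrow> ell1" and A i
    by (induction A rule: infinite_finite_induct) (simp_all add: zero_ell1.rep_eq plus_ell1.rep_eq)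
  have coord_sum: "coord (sum f A) i = (\<Sum>a\<in>A. coord (f a) i)" for f :: "nat \<Rightarrow> cfin" and A i
    by (induction A rule: infinite_finite_induct) (simp_all add: zero_cfin.rep_eq plus_cfin.rep_eq)
  have pair: "hpair z (w i) = ell1_nth (\<phi> z) i" if z: "z \<in> Cspace k" for z i
  proof -
    have "z = (\<Sum>j<k. coord z j *\<^sub>C basis_vec j)"
      using z by (intro cfin_eqI)
        (auto simp: coord_sum scaleC_cfin.rep_eq coord_basis_vec Cspace_def if_distrib[of "(*) _"] sum.delta' not_less cong: if_cong)
    then have "ell1_nth (\<phi> z) i = ell1_nth (\<Sum>j<k. coord z j *\<^sub>C \<phi> (basis_vec j)) i"
      by (metis (no_types, lifting) sum scale sum.cong)
    also have "\<dots> = (\<Sum>j<k. coord z j * cnj (coord (w i) j))"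
      by (simp add: nth_sum scaleC_ell1.rep_eq cw)
    also have "\<dots> = hpair z (w i)"
      unfolding hpair_def by (rule sum.mono_neutral_right) (auto simp: cw split: if_splits)
    finally show ?thesis ..
  qed
  have "summable_functionals k w"
  proof
    have "norm (w i) \<le> (\<Sum>j<k. cmod (ell1_nth (\<phi> (basis_vec j)) i))" for i
      unfolding norm_Cspace[OF wC]
      using L2_set_le_sum[of "{..<k}" "\<lambda>j. cmod (coord (w i) j)"] by (simp add: L2_set_def cw)
    then show "summable (\<lambda>i. norm (w i))"
      by (intro summable_comparison_test'[OF summable_sum[OF summable_cmod_ell1], of 0]) auto
    show "z = 0" if z: "z \<in> Cspace k" and 0: "\<And>i. hpair z (w i) = 0" for z
    proof -
      have "ell1_nth (\<phi> z) i = 0" for i using pair[OF z] 0 by metis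
      then have "\<phi> z = \<phi> 0" by (intro ell1_eqI) (simp add: zero zero_ell1.rep_eq)
      moreover have "0 \<in> Cspace k" by (simp add: Cspace_def zero_cfin.rep_eq)
      ultimately show "z = 0" using inj z by (blast dest: inj_onD)
    qed
  qed (rule wC)
  then show thesis using that pair by blast
qed

theorem theorem3p17:
  shows "strongly_pseudoconvex (ball 0 1 :: ell1 set)"
  unfolding strongly_pseudoconvex_def
proof (intro conjI allI impI)
  fix M :: "ell1 set" and k and \<phi> :: "cfin \<Rightarrow> ell1"
  assume "Vector_Spaces.linear scaleC scaleC \<phi> \<and> bij_betw \<phi> (Cspace k) M"
  then have lin: "Vector_Spaces.linear scaleC scaleC \<phi>" and bij: "bij_betw \<phi> (Cspace k) M" by auto
  obtain w where "summable_functionals k w"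
    and w: "\<And>z i. z \<in> Cspace k \<Longrightarrow> hpair z (w i) = ell1_nth (\<phi> z) i"
    using summable_functionals_into_ell1[OF lin bij_betw_imp_inj_on[OF bij]] by blast
  then interpret summable_functionals k w by simp
  have "pullback_norm z = norm (\<phi> z)" if "z \<in> Cspace k" for z
    by (simp add: pullback_norm_def norm_ell1_def w[OF that])
  then have "{z \<in> Cspace k. \<phi> z \<in> ball 0 1 \<inter> M} = {z \<in> Cspace k. pullback_norm z < 1}"
    using bij_betwE[OF bij] by auto
  then show "zero_unif_pseudoconvex k {z \<in> Cspace k. \<phi> z \<in> ball 0 1 \<inter> M}"
    using zero_unif_pseudoconvex_pullback_ball by simp
qed auto

end
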